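(* Let $\mathcal N$ be a $\mathrm{ReLU}$ net with depth $d$ and layer widths $n_0,\dots,n_d$, evaluated at a fixed input $\mathrm{Act}^{(0)}\in\mathbb{R}^{n_0}$. Fix $0\le j<j'\le d$. Suppose the weight matrices $W^{(i)}\in\mathrm{Mat}(n_i,n_{i-1})$ of $\mathcal N$ are independent with i.i.d. entries drawn from a distribution $\mu$ satisfying (i)-(iv) of the context, and that the biases are i.i.d., independent of the weights, drawn from a measure which also satisfies (i)-(iv). Let $\eta^{(j')}$ be an $n_{j'}$-dimensional random vector, independent of the weights and biases, whose entries are independent and take the values $\pm1$ with probability $1/2$ each. Then $$\mathrm{Diag}(\eta^{(j')})\,\mathrm{Jac}^{(j\to j')}\ \stackrel{d}{=}\ D^{(j')}W^{(j')}D^{(j'-1)}W^{(j'-1)}\cdots D^{(j+1)}W^{(j+1)},$$ where $D^{(i)}$ are independent $n_i\times n_i$ diagonal matrices, independent of the $W^{(i)}$'s, whose diagonal entries are i.i.d. $\{0,1\}$-valued Bernoulli random variables with parameter $p=\frac12$, and $\stackrel{d}{=}$ denotes equality in distribution.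
   Context: Conditions on a measure $\mu$ on $\mathbb{R}$: if $W\sim\mu$, then (i) $\mathbb{E}[W]=0$, $\mathbb{E}[W^2]=1$; (ii) $W$ and $-W$ have the same distribution; (iii) all moments are finite; (iv) $\mathbb{P}(W=x)=0$ for every $x\in\mathbb{R}$. A $\mathrm{ReLU}$ net with depth $d$ and layer widths $n_0,\dots,n_d$ is the function $\mathcal N=\mathrm{ReLU}\circ A^{(d)}\circ\cdots\circ\mathrm{ReLU}\circ A^{(1)}$ with $A^{(i)}(\vec x)=W^{(i)}\vec x+\vec B^{(i)}$, $W^{(i)}\in\mathrm{Mat}(n_i,n_{i-1})$ (weights), $\vec B^{(i)}\in\mathbb{R}^{n_i}$ (biases), and $\mathrm{ReLU}(v_1,\dots,v_m)=(\max\{0,v_1\},\dots,\max\{0,v_m\})$. For an input $\mathrm{Act}^{(0)}\in\mathbb{R}^{n_0}$, put $\mathrm{act}^{(i)}=W^{(i)}\mathrm{Act}^{(i-1)}+\vec B^{(i)}$ and $\mathrm{Act}^{(i)}=\mathrm{ReLU}(\mathrm{act}^{(i)})$. The layer-to-layer Jacobian is $$\mathrm{Jac}^{(j\to j')}=\left(\partial\,\mathrm{Act}^{(j')}_a/\partial\,\mathrm{Act}^{(j)}_b\right)_{1\le a\le n_{j'},\,1\le b\le n_j},$$ i.e. the derivative at $\mathrm{Act}^{(j)}$ of the map from layer $j$ activations to layer $j'$ activations (almost surely defined). $\mathrm{Diag}(v)$ is the diagonal matrix with diagonal $v$. *)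

theory Defs
  imports "HOL-Probability.Probability" "Jordan_Normal_Form.Matrix"
begin

unbundle no vec_syntax

definition admissible :: "real measure \<Rightarrow> bool" where
  "admissible \<mu> \<longleftrightarrow>
     real_distribution \<mu> \<and>
     (\<integral>x. x \<partial>\<mu>) = 0 \<and> (\<integral>x. x\<^sup>2 \<partial>\<mu>) = 1 \<and>
     distr \<mu> borel uminus = \<mu> \<and>
     (\<forall>k::nat. integrable \<mu> (\<lambda>x. x ^ k)) \<and>
     (\<forall>x. measure \<mu> {x} = 0)"

definition relu :: "real Matrix.vec \<Rightarrow> real Matrix.vec" where
  "relu v = map_vec (\<lambda>t. max 0 t) v"

definition Diag :: "real Matrix.vec \<Rightarrow> real Matrix.mat" where
  "Diag v = mat_diag (dim_vec v) (\<lambda>a. v $ a)"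

(* Layers are numbered as usual (weights and biases of layers 1..d), but the coordinates
   within a layer of width n i are 0-based: a < n i.  For j \<le> j', layer_map W B j j' sends
   the activations of layer j to those of layer j'; so layer_map W B 0 d is the net and
   layer_map W B 0 j x is Act^(j) on input x. *)
definition layer_map ::
  "(nat \<Rightarrow> real Matrix.mat) \<Rightarrow> (nat \<Rightarrow> real Matrix.vec) \<Rightarrow> nat \<Rightarrow> nat \<Rightarrow> real Matrix.vec \<Rightarrow> real Matrix.vec"
  where "layer_map W B j j' = fold (\<lambda>i v. relu (W i *\<^sub>v v + B i)) [Suc j..<Suc j']"

(* Matrix of partial derivatives at x of a map F from R^k to R^m.  Where a partial derivative
   does not exist, deriv returns an unspecified constant. *)
definition jacobian ::
  "nat \<Rightarrow> nat \<Rightarrow> (real Matrix.vec \<Rightarrow> real Matrix.vec) \<Rightarrow> real Matrix.vec \<Rightarrow> real Matrix.mat" where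
  "jacobian m k F x =
     Matrix.mat m k (\<lambda>(a, b). deriv (\<lambda>t. F (x + t \<cdot>\<^sub>v unit_vec k b) $ a) 0)"

definition Jac ::
  "(nat \<Rightarrow> nat) \<Rightarrow> (nat \<Rightarrow> real Matrix.mat) \<Rightarrow> (nat \<Rightarrow> real Matrix.vec) \<Rightarrow> real Matrix.vec \<Rightarrow> nat \<Rightarrow> nat \<Rightarrow> real Matrix.mat"
  where "Jac n W B x j j' = jacobian (n j') (n j) (layer_map W B j j') (layer_map W B 0 j x)"

(* The product D j' * W j' * ... * D (j + 1) * W (j + 1). *)
definition gated_product ::
  "(nat \<Rightarrow> nat) \<Rightarrow> (nat \<Rightarrow> real Matrix.mat) \<Rightarrow> (nat \<Rightarrow> real Matrix.mat) \<Rightarrow> nat \<Rightarrow> nat \<Rightarrow> real Matrix.mat"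
  where "gated_product n D W j j' = fold (\<lambda>i P. D i * W i * P) [Suc j..<Suc j'] (1\<^sub>m (n j))"

(* The Borel sigma-algebra on the m x k real matrices, via their entries. *)
definition mat_borel :: "nat \<Rightarrow> nat \<Rightarrow> real Matrix.mat measure" where
  "mat_borel m k =
     vimage_algebra (carrier_mat m k)
       (\<lambda>A. restrict (\<lambda>p. A $$ p) ({..<m} \<times> {..<k}))
       (PiM ({..<m} \<times> {..<k}) (\<lambda>_. borel))"

(* Names for the scalar random variables in play, so that joint independence of the entries of
   several random matrices and vectors is independence of one indexed family. *)
datatype coord = Weight nat nat nat | Bias nat nat | Sign nat | Mask nat nat

primrec coord_rv ::
  "(nat \<Rightarrow> 'w \<Rightarrow> real Matrix.mat) \<Rightarrow> (nat \<Rightarrow> 'w \<Rightarrow> real Matrix.vec) \<Rightarrow> ('w \<Rightarrow> real Matrix.vec) \<Rightarrow>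
   (nat \<Rightarrow> 'w \<Rightarrow> real Matrix.mat) \<Rightarrow> coord \<Rightarrow> 'w \<Rightarrow> real" where
  "coord_rv W B \<eta> D (Weight i a b) = (\<lambda>\<omega>. W i \<omega> $$ (a, b))"
| "coord_rv W B \<eta> D (Bias i a) = (\<lambda>\<omega>. B i \<omega> $ a)"
| "coord_rv W B \<eta> D (Sign a) = (\<lambda>\<omega>. \<eta> \<omega> $ a)"
| "coord_rv W B \<eta> D (Mask i a) = (\<lambda>\<omega>. D i \<omega> $$ (a, a))"

definition weight_coords :: "(nat \<Rightarrow> nat) \<Rightarrow> nat \<Rightarrow> coord set" where
  "weight_coords n d = {Weight i a b | i a b. i \<in> {1..d} \<and> a < n i \<and> b < n (i - 1)}"

definition bias_coords :: "(nat \<Rightarrow> nat) \<Rightarrow> nat \<Rightarrow> coord set" where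
  "bias_coords n d = {Bias i a | i a. i \<in> {1..d} \<and> a < n i}"

definition sign_coords :: "nat \<Rightarrow> coord set" where
  "sign_coords m = {Sign a | a. a < m}"

definition mask_coords :: "(nat \<Rightarrow> nat) \<Rightarrow> nat \<Rightarrow> nat \<Rightarrow> coord set" where
  "mask_coords n j j' = {Mask i a | i a. i \<in> {j<..j'} \<and> a < n i}"

end

theory Submission
  imports Defs
begin

text \<open>Almost surely no preactivation vanishes, so that the Jacobian is the product of the weight
  matrices and of the diagonal matrices of open gates.  The proof adds one layer at a time.  Fix
  the input \<open>v\<close> of a layer and the Jacobian \<open>P\<close> of the layers before it.  Flipping the rows of
  \<open>(W, B)\<close> by the random signs \<open>\<eta>\<close> does not change their law, and it turns
  \<open>Diag \<eta> * gate (W v + B) * W * P\<close> into \<open>gate (Diag \<eta> (W v + B)) * W * P\<close>, whose gates are fair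
  coins independent of \<open>W\<close>.  So the law of the left-hand side is that of \<open>D * W * P\<close>: it depends
  on \<open>P\<close> only, and, the columns of \<open>W\<close> being symmetric, only up to the signs of the rows of \<open>P\<close>.
  Hence the induction hypothesis is needed for sign-invariant functions of the Jacobian only.\<close>

section \<open>The Jacobian of a ReLU network\<close>

text \<open>The obstacle is that a gate is computed from the very weights it multiplies: an open
  gate favours weights aligned with the input of the layer, so without signs the two laws differ in
  general. Signs exist only at the last layer, yet every layer must be decoupled. A test function
  that ignores row signs allows fresh signs to be inserted at an inner layer at no cost, and
  integrating out one layer produces just such a test function for the layers below. Once a layer is
  integrated out, its input \<open>v\<close> has disappeared, so that the dependence between
  \<open>v\<close> and \<open>P\<close> does no harm. Laws are therefore compared through
  nonnegative integrals over product measures indexed by \<open>coord\<close>, where layers separate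
  by Fubini and a change of variables need only preserve the law of each coordinate. Preactivations
  are nonzero because a bias has no atoms and is independent of the rest of its preactivation; this
  covers an input \<open>v\<close> that ReLU has made zero.\<close>

lemma index_mult_mat_vec_sum:
  assumes "A \<in> carrier_mat p q" "v \<in> carrier_vec q" "a < p"
  shows "(A *\<^sub>v v) $ a = (\<Sum>c<q. A $$ (a, c) * v $ c)"
  using assms by (auto simp: scalar_prod_def lessThan_atLeast0)

lemma index_mult_mat_sum:
  assumes "A \<in> carrier_mat p q" "P \<in> carrier_mat q r" "a < p" "b < r"
  shows "(A * P) $$ (a, b) = (\<Sum>c<q. A $$ (a, c) * P $$ (c, b))"
  using assms by (auto simp: scalar_prod_def lessThan_atLeast0)

lemma index_mat_diag_mult:
  assumes "A \<in> carrier_mat p q" "a < p" "b < q"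
  shows "(mat_diag p f * A) $$ (a, b) = f a * A $$ (a, b)"
  using assms by (simp add: mat_diag_mult_left[OF assms(1)])

text \<open>The derivative of ReLU at \<open>u\<close> when no entry vanishes; an entry equal to 0
  is given a closed gate.\<close>

definition gate :: "real Matrix.vec \<Rightarrow> real Matrix.mat" where
  "gate u = mat_diag (dim_vec u) (\<lambda>a. of_bool (0 < u $ a))"

lemma gate_carrier [simp]: "u \<in> carrier_vec p \<Longrightarrow> gate u \<in> carrier_mat p p"
  by (auto simp: gate_def)

definition preact ::
  "(nat \<Rightarrow> real Matrix.mat) \<Rightarrow> (nat \<Rightarrow> real Matrix.vec) \<Rightarrow> real Matrix.vec \<Rightarrow> nat \<Rightarrow> real Matrix.vec" where
  "preact W B x i = W i *\<^sub>v layer_map W B 0 (i - 1) x + B i"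

lemma layer_map_same [simp]: "layer_map W B j j y = y"
  by (simp add: layer_map_def)

lemma layer_map_Suc:
  "j \<le> k \<Longrightarrow> layer_map W B j (Suc k) y = relu (W (Suc k) *\<^sub>v layer_map W B j k y + B (Suc k))"
  by (simp add: layer_map_def)

text \<open>Identifies the preactivations met when starting from layer \<open>j\<close> with those
  of the whole net on input \<open>x\<close>, to which the nonvanishing assumption refers.\<close>

lemma layer_map_layer_map:
  "j \<le> k \<Longrightarrow> layer_map W B j k (layer_map W B 0 j x) = layer_map W B 0 k x"
  by (induction k rule: dec_induct) (simp_all add: layer_map_Suc)

lemma layer_map_cong:
  assumes "\<And>i. j < i \<Longrightarrow> i \<le> k \<Longrightarrow> W i = W' i" "\<And>i. j < i \<Longrightarrow> i \<le> k \<Longrightarrow> B i = B' i"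
  shows "layer_map W B j k = layer_map W' B' j k"
  unfolding layer_map_def by (intro ext fold_cong) (auto simp: assms)

text \<open>Shapes are assumed at every index, 0 included: the eventual arguments are
  \<open>weight_mat\<close> and \<open>bias_vec\<close>, which have the right shape
  throughout.\<close>

lemma layer_map_carrier:
  assumes "\<And>i. W i \<in> carrier_mat (n i) (n (i - 1))" "\<And>i. B i \<in> carrier_vec (n i)"
    and "j \<le> k" "y \<in> carrier_vec (n j)"
  shows "layer_map W B j k y \<in> carrier_vec (n k)"
  using assms(3)
proof (induction k rule: dec_induct)
  case (step k)
  then show ?case
    using assms(1)[of "Suc k"] assms(2)[of "Suc k"] by (auto simp: layer_map_Suc relu_def)
qed (use assms in simp)

lemma gated_product_same [simp]: "gated_product n D W j j = 1\<^sub>m (n j)"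
  by (simp add: gated_product_def)

lemma gated_product_Suc:
  "j \<le> k \<Longrightarrow> gated_product n D W j (Suc k) = D (Suc k) * W (Suc k) * gated_product n D W j k"
  by (simp add: gated_product_def)

lemma gated_product_cong:
  assumes "\<And>i. j < i \<Longrightarrow> i \<le> k \<Longrightarrow> D i = D' i" "\<And>i. j < i \<Longrightarrow> i \<le> k \<Longrightarrow> W i = W' i"
  shows "gated_product n D W j k = gated_product n D' W' j k"
  unfolding gated_product_def by (intro fold_cong) (auto simp: assms)

lemma gated_product_carrier:
  assumes "\<And>i. j < i \<Longrightarrow> i \<le> k \<Longrightarrow> W i \<in> carrier_mat (n i) (n (i - 1))"
    and "\<And>i. j < i \<Longrightarrow> i \<le> k \<Longrightarrow> D i \<in> carrier_mat (n i) (n i)"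
    and "j \<le> k"
  shows "gated_product n D W j k \<in> carrier_mat (n k) (n j)"
  using assms(3,1,2)
proof (induction k rule: dec_induct)
  case (step k)
  then have "gated_product n D W j k \<in> carrier_mat (n k) (n j)" by simp
  then show ?case
    using step(4)[of "Suc k"] step(5)[of "Suc k"] \<open>j \<le> k\<close> by (auto simp: gated_product_Suc)
qed auto

lemma preact_carrier:
  assumes "\<And>i. W i \<in> carrier_mat (n i) (n (i - 1))" "\<And>i. B i \<in> carrier_vec (n i)"
    and "x \<in> carrier_vec (n 0)"
  shows "preact W B x i \<in> carrier_vec (n i)"
proof -
  have "layer_map W B 0 (i - 1) x \<in> carrier_vec (n (i - 1))"
    by (rule layer_map_carrier) (use assms in auto)
  then have "W i *\<^sub>v layer_map W B 0 (i - 1) x \<in> carrier_vec (n i)"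
    using assms(1)[of i] by (rule mult_mat_vec_carrier[rotated])
  then show ?thesis
    using assms(2)[of i] by (simp add: preact_def)
qed

lemma layer_map_Suc_index:
  assumes "\<And>i. W i \<in> carrier_mat (n i) (n (i - 1))" "\<And>i. B i \<in> carrier_vec (n i)"
    and "j \<le> k" "y \<in> carrier_vec (n j)" "a < n (Suc k)"
  shows "layer_map W B j (Suc k) y $ a =
    max 0 ((\<Sum>c<n k. W (Suc k) $$ (a, c) * layer_map W B j k y $ c) + B (Suc k) $ a)"
proof -
  have "layer_map W B j k y \<in> carrier_vec (n k)"
    using layer_map_carrier assms by blast
  then show ?thesis
    using assms(1)[of "Suc k"] assms(2)[of "Suc k"] assms(3-)
    by (subst layer_map_Suc)
       (auto simp: relu_def index_mult_mat_vec_sum[of _ "n (Suc k)" "n k"] simp del: index_mult_mat_vec)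
qed

text \<open>The filter is left free so that the same step serves full neighbourhoods of 0, where the
  Jacobian is computed, and one-sided ones, where measurability is obtained.\<close>

lemma eventually_affine_sum:
  fixes f :: "nat \<Rightarrow> real \<Rightarrow> real"
  assumes "\<And>c. c < m \<Longrightarrow> \<forall>\<^sub>F t in F. f c t = g c + D c * t"
  shows "\<forall>\<^sub>F t in F. (\<Sum>c<m. w c * f c t) + r = ((\<Sum>c<m. w c * g c) + r) + (\<Sum>c<m. w c * D c) * t"
proof -
  have "\<forall>\<^sub>F t in F. \<forall>c\<in>{..<m}. f c t = g c + D c * t"
    using assms by (intro eventually_ball_finite) auto
  then show ?thesis
  proof eventually_elim
    case (elim t)
    then have "(\<Sum>c<m. w c * f c t) = (\<Sum>c<m. w c * (g c + D c * t))"
      by (intro sum.cong) auto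
    then show ?case
      by (simp add: algebra_simps sum.distrib sum_distrib_left)
  qed
qed

text \<open>By continuity the affine function keeps the sign of \<open>u\<close> near 0, so ReLU
  acts there as the identity or as zero.\<close>

lemma eventually_max_affine:
  fixes u D :: real
  assumes F: "F \<le> nhds 0" and ev: "\<forall>\<^sub>F t in F. f t = u + D * t" and "u \<noteq> 0"
  shows "\<forall>\<^sub>F t in F. max 0 (f t) = max 0 u + of_bool (0 < u) * D * t"
proof -
  have "((\<lambda>t. u + D * t) \<longlongrightarrow> u + D * 0) (nhds 0)"
    by (intro tendsto_intros filterlim_ident)
  then have lim: "((\<lambda>t. u + D * t) \<longlongrightarrow> u) F"
    using F by (simp add: tendsto_mono)
  show ?thesis
  proof (cases "u > 0")
    case True
    have "\<forall>\<^sub>F t in F. u + D * t > 0"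
      by (rule order_tendstoD(1)[OF lim True])
    with ev show ?thesis by eventually_elim (use True in auto)
  next
    case False
    with \<open>u \<noteq> 0\<close> have "u < 0" by simp
    have "\<forall>\<^sub>F t in F. u + D * t < 0"
      by (rule order_tendstoD(2)[OF lim \<open>u < 0\<close>])
    with ev show ?thesis by eventually_elim (use \<open>u < 0\<close> in auto)
  qed
qed

text \<open>At the kink \<open>u = 0\<close> the sign of \<open>D * t\<close> is constant on each
  side of 0, which gives the slope \<open>max 0 D\<close> on the right and \<open>min 0 D\<close> on
  the left.\<close>

lemma eventually_max_affine_one_sided:
  fixes u D :: real
  assumes F: "F = at_left 0 \<or> F = at_right 0" and ev: "\<forall>\<^sub>F t in F. f t = u + D * t"
  shows "\<exists>D'. \<forall>\<^sub>F t in F. max 0 (f t) = max 0 u + D' * t"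
proof (cases "u = 0")
  case False
  have "F \<le> nhds 0"
    using F by (auto simp: at_within_def)
  from eventually_max_affine[OF this ev False] show ?thesis by blast
next
  case True
  from F show ?thesis
  proof
    assume "F = at_right 0"
    then have "\<forall>\<^sub>F t in F. t > 0" by (simp add: eventually_at_right_less)
    with ev have "\<forall>\<^sub>F t in F. max 0 (f t) = max 0 u + max 0 D * t"
      by eventually_elim (auto simp: True max_def mult_le_0_iff zero_le_mult_iff)
    then show ?thesis by blast
  next
    assume "F = at_left 0"
    then have "\<forall>\<^sub>F t in F. t < 0" by (simp add: eventually_at_filter)
    with ev have "\<forall>\<^sub>F t in F. max 0 (f t) = max 0 u + min 0 D * t"
      by eventually_elim (auto simp: True max_def min_def mult_le_0_iff zero_le_mult_iff)
    then show ?thesis by blast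
  qed
qed

text \<open>A ReLU net is piecewise affine, hence affine on a short segment leaving any point,
  including points on a kink. This is the input to the measurability of the Jacobian.\<close>

lemma layer_map_one_sided_affine:
  assumes W: "\<And>i. W i \<in> carrier_mat (n i) (n (i - 1))" and B: "\<And>i. B i \<in> carrier_vec (n i)"
    and "j \<le> k" and y: "y \<in> carrier_vec (n j)" "e \<in> carrier_vec (n j)"
    and F: "F = at_left 0 \<or> F = at_right 0"
  shows "\<forall>a<n k. \<exists>D. \<forall>\<^sub>F t in F.
    layer_map W B j k (y + t \<cdot>\<^sub>v e) $ a = layer_map W B j k y $ a + D * t"
  using \<open>j \<le> k\<close>
proof (induction k rule: dec_induct)
  case base
  show ?case using y by (auto intro!: exI[of _ "e $ _"])
next
  case (step k)
  then obtain D where D: "\<And>c. c < n k \<Longrightarrow> \<forall>\<^sub>F t in F.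
      layer_map W B j k (y + t \<cdot>\<^sub>v e) $ c = layer_map W B j k y $ c + D c * t"
    by metis
  show ?case
  proof (intro allI impI)
    fix a assume a: "a < n (Suc k)"
    have y': "y + t \<cdot>\<^sub>v e \<in> carrier_vec (n j)" for t
      using y by simp
    show "\<exists>D. \<forall>\<^sub>F t in F. layer_map W B j (Suc k) (y + t \<cdot>\<^sub>v e) $ a =
        layer_map W B j (Suc k) y $ a + D * t"
      unfolding layer_map_Suc_index[where W=W and n=n and B=B, OF W B step(1) y(1) a]
        layer_map_Suc_index[where W=W and n=n and B=B, OF W B step(1) y' a]
      by (rule eventually_max_affine_one_sided[OF F eventually_affine_sum[OF D]])
  qed
qed

text \<open>The map is shown to equal an affine function near 0, not merely to have a derivative
  there. Exact equality passes through sums and ReLU by elementary means, and the slope multiplies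
  up to the gated product without a chain rule.\<close>

lemma layer_map_affine:
  assumes W: "\<And>i. W i \<in> carrier_mat (n i) (n (i - 1))" and B: "\<And>i. B i \<in> carrier_vec (n i)"
    and "j \<le> k" and x: "x \<in> carrier_vec (n 0)" and b: "b < n j"
    and nz: "\<And>i a. j < i \<Longrightarrow> i \<le> k \<Longrightarrow> a < n i \<Longrightarrow> preact W B x i $ a \<noteq> 0"
  defines "y \<equiv> layer_map W B 0 j x"
  shows "\<forall>a<n k. \<forall>\<^sub>F t in nhds 0.
    layer_map W B j k (y + t \<cdot>\<^sub>v unit_vec (n j) b) $ a =
    layer_map W B j k y $ a + gated_product n (\<lambda>i. gate (preact W B x i)) W j k $$ (a, b) * t"
  using \<open>j \<le> k\<close> nz
proof (induction k rule: dec_induct)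
  have y: "y \<in> carrier_vec (n j)"
    unfolding y_def using layer_map_carrier[of W n B 0 j x] W B x by simp
  {
    case base
    show ?case using y b by (auto simp: carrier_vecD[OF y])
  next
    case (step k)
    let ?G = "gated_product n (\<lambda>i. gate (preact W B x i)) W j"
    have y': "y + t \<cdot>\<^sub>v unit_vec (n j) b \<in> carrier_vec (n j)" for t
      using y by simp
    have G: "?G k \<in> carrier_mat (n k) (n j)"
      using W preact_carrier[of W n B x] B x step(1) by (intro gated_product_carrier) auto
    show ?case
    proof (intro allI impI)
      fix a assume a: "a < n (Suc k)"
      define u where "u = (\<Sum>c<n k. W (Suc k) $$ (a, c) * layer_map W B j k y $ c) + B (Suc k) $ a"
      have pre: "preact W B x (Suc k) \<in> carrier_vec (n (Suc k))"
        using preact_carrier[of W n B x] W B x by blast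
      \<comment> \<open>The affine sum at the base point is the preactivation of the whole net, so
        \<open>nz\<close> keeps it away from the kink.\<close>
      have "preact W B x (Suc k) $ a = u"
        unfolding u_def y_def layer_map_layer_map[OF step(1)] preact_def
        using W[of "Suc k"] B[of "Suc k"] layer_map_carrier[of W n B 0 k x, OF W B _ x] a
        by (simp add: index_mult_mat_vec_sum[of _ "n (Suc k)" "n k"] del: index_mult_mat_vec)
      then have u: "u \<noteq> 0" "gate (preact W B x (Suc k)) = mat_diag (n (Suc k)) (\<lambda>a. of_bool (0 < preact W B x (Suc k) $ a))"
          "preact W B x (Suc k) $ a = u"
        using step(4)[of "Suc k" a] step(1) a pre by (auto simp: gate_def)
      have eq: "?G (Suc k) $$ (a, b) = of_bool (0 < u) * (\<Sum>c<n k. W (Suc k) $$ (a, c) * ?G k $$ (c, b))"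
      proof -
        have "W (Suc k) \<in> carrier_mat (n (Suc k)) (n k)" using W[of "Suc k"] by simp
        then have "?G (Suc k) = mat_diag (n (Suc k)) (\<lambda>a. of_bool (0 < preact W B x (Suc k) $ a)) * (W (Suc k) * ?G k)"
          unfolding gated_product_Suc[OF step(1)] u(2) using G
          by (intro assoc_mult_mat[of _ "n (Suc k)" "n (Suc k)" _ "n k" _ "n j"]) auto
        with \<open>W (Suc k) \<in> carrier_mat (n (Suc k)) (n k)\<close> show ?thesis
          using G a b u(3) 
          by (simp add: index_mat_diag_mult[of _ "n (Suc k)" "n j"]
              index_mult_mat_sum[of _ "n (Suc k)" "n k" _ "n j"] del: index_mult_mat)
      qed
      have "\<forall>\<^sub>F t in nhds 0. layer_map W B j k (y + t \<cdot>\<^sub>v unit_vec (n j) b) $ c =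
          layer_map W B j k y $ c + ?G k $$ (c, b) * t" if "c < n k" for c
        using step that by simp
      then have "\<forall>\<^sub>F t in nhds 0.
          (\<Sum>c<n k. W (Suc k) $$ (a, c) * layer_map W B j k (y + t \<cdot>\<^sub>v unit_vec (n j) b) $ c) + B (Suc k) $ a =
          u + (\<Sum>c<n k. W (Suc k) $$ (a, c) * ?G k $$ (c, b)) * t"
        unfolding u_def by (rule eventually_affine_sum)
      from eventually_max_affine[OF order_refl this u(1)]
      show "\<forall>\<^sub>F t in nhds 0. layer_map W B j (Suc k) (y + t \<cdot>\<^sub>v unit_vec (n j) b) $ a =
          layer_map W B j (Suc k) y $ a + ?G (Suc k) $$ (a, b) * t"
        unfolding layer_map_Suc_index[where W=W and n=n and B=B, OF W B step(1) y a]
          layer_map_Suc_index[where W=W and n=n and B=B, OF W B step(1) y' a] eq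
        unfolding u_def .
    qed
  }
qed

text \<open>Near the base point each entry of the layer map coincides with an affine function of
  \<open>t\<close>, so \<open>deriv\<close> returns its slope.\<close>

lemma Jac_eq_gated_product:
  assumes W: "\<And>i. W i \<in> carrier_mat (n i) (n (i - 1))" and B: "\<And>i. B i \<in> carrier_vec (n i)"
    and "j \<le> k" and x: "x \<in> carrier_vec (n 0)"
    and nz: "\<And>i a. j < i \<Longrightarrow> i \<le> k \<Longrightarrow> a < n i \<Longrightarrow> preact W B x i $ a \<noteq> 0"
  shows "Jac n W B x j k = gated_product n (\<lambda>i. gate (preact W B x i)) W j k"
    (is "_ = ?G")
proof (rule eq_matI)
  have G: "?G \<in> carrier_mat (n k) (n j)"
    using W preact_carrier[of W n B x] B x \<open>j \<le> k\<close> by (intro gated_product_carrier) auto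
  then show "dim_row (Jac n W B x j k) = dim_row ?G" "dim_col (Jac n W B x j k) = dim_col ?G"
    by (auto simp: Jac_def jacobian_def)
  fix a b assume "a < dim_row ?G" "b < dim_col ?G"
  with G have ab: "a < n k" "b < n j" by auto
  let ?y = "layer_map W B 0 j x"
  let ?f = "\<lambda>t. layer_map W B j k (?y + t \<cdot>\<^sub>v unit_vec (n j) b) $ a"
  let ?g = "\<lambda>t. layer_map W B j k ?y $ a + ?G $$ (a, b) * t"
  have "\<forall>\<^sub>F t in nhds 0. ?f t = ?g t"
    using layer_map_affine[where W=W and n=n and B=B, OF W B \<open>j \<le> k\<close> x ab(2) nz] ab(1) by blast
  then have "deriv ?f 0 = deriv ?g 0"
    by (rule deriv_cong_ev) simp
  also have "\<dots> = ?G $$ (a, b)"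
    by (rule DERIV_imp_deriv) (auto intro!: derivative_eq_intros)
  finally show "Jac n W B x j k $$ (a, b) = ?G $$ (a, b)"
    using ab by (simp add: Jac_def jacobian_def)
qed

text \<open>At a kink \<^const>\<open>deriv\<close> is an unspecified constant, so measurability everywhere is obtained
  from the one-sided derivatives, which always exist and are limits of difference quotients.\<close>

lemma measurable_deriv_one_sided_affine:
  fixes f :: "'a \<Rightarrow> real \<Rightarrow> real"
  assumes meas: "\<And>t. (\<lambda>\<omega>. f \<omega> t) \<in> borel_measurable N"
    and R: "\<And>\<omega>. \<omega> \<in> space N \<Longrightarrow> \<exists>D. \<forall>\<^sub>F t in at_right 0. f \<omega> t = f \<omega> 0 + D * t"
    and L: "\<And>\<omega>. \<omega> \<in> space N \<Longrightarrow> \<exists>D. \<forall>\<^sub>F t in at_left 0. f \<omega> t = f \<omega> 0 + D * t"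
  shows "(\<lambda>\<omega>. deriv (f \<omega>) 0) \<in> borel_measurable N"
proof -
  \<comment> \<open>A positive null sequence: along \<open>h\<close> and \<open>- h\<close> the
    difference quotients are eventually equal to the one-sided slopes, and a limit over a sequence
    preserves measurability.\<close>
  define h :: "nat \<Rightarrow> real" where "h m = inverse (real (Suc m))" for m
  have h0: "h m > 0" "h m \<noteq> 0" for m by (simp_all add: h_def)
  have lim_h: "h \<longlonglongrightarrow> 0"
    unfolding h_def by (rule LIMSEQ_inverse_real_of_nat)
  have right: "filterlim h (at_right 0) sequentially"
    using lim_h h0 by (auto simp: filterlim_at)
  have left: "filterlim (\<lambda>m. - h m) (at_left 0) sequentially"
    using tendsto_minus[OF lim_h] h0 by (auto simp: filterlim_at)
  define r where "r \<omega> = lim (\<lambda>m. (f \<omega> (h m) - f \<omega> 0) / h m)" for \<omega>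
  define l where "l \<omega> = lim (\<lambda>m. (f \<omega> (- h m) - f \<omega> 0) / (- h m))" for \<omega>
  have [measurable]: "r \<in> borel_measurable N" "l \<in> borel_measurable N"
    unfolding r_def[abs_def] l_def[abs_def] using meas by measurable
  have r: "\<forall>\<^sub>F t in at_right 0. f \<omega> t = f \<omega> 0 + r \<omega> * t" if "\<omega> \<in> space N" for \<omega>
  proof -
    obtain D where D: "\<forall>\<^sub>F t in at_right 0. f \<omega> t = f \<omega> 0 + D * t"
      using R[OF \<open>\<omega> \<in> space N\<close>] by blast
    have "\<forall>\<^sub>F m in sequentially. (f \<omega> (h m) - f \<omega> 0) / h m = D"
      using eventually_compose_filterlim[OF D right]
    proof eventually_elim
      case (elim m) then show ?case using h0[of m] by (simp add: field_simps)
    qed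
    then have "r \<omega> = D"
      unfolding r_def by (intro limI tendsto_eventually)
    with D show ?thesis by simp
  qed
  have l: "\<forall>\<^sub>F t in at_left 0. f \<omega> t = f \<omega> 0 + l \<omega> * t" if "\<omega> \<in> space N" for \<omega>
  proof -
    obtain D where D: "\<forall>\<^sub>F t in at_left 0. f \<omega> t = f \<omega> 0 + D * t"
      using L[OF \<open>\<omega> \<in> space N\<close>] by blast
    have "\<forall>\<^sub>F m in sequentially. (f \<omega> (- h m) - f \<omega> 0) / (- h m) = D"
      using eventually_compose_filterlim[OF D left]
    proof eventually_elim
      case (elim m) then show ?case using h0[of m] by (simp add: field_simps)
    qed
    then have "l \<omega> = D"
      unfolding l_def by (intro limI tendsto_eventually)
    with D show ?thesis by simp
  qed
  have aff: "(g has_real_derivative D) (at 0 within S)" if "\<forall>\<^sub>F t in at 0 within S. g t = g 0 + D * t"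
    for g :: "real \<Rightarrow> real" and D S
  proof -
    have "\<forall>\<^sub>F t in at 0 within S. t \<noteq> 0"
      by (simp add: eventually_at_filter)
    with that have "\<forall>\<^sub>F t in at 0 within S. (g t - g 0) / (t - 0) = D"
      by eventually_elim simp
    then show ?thesis
      unfolding has_field_derivative_iff by (rule tendsto_eventually)
  qed
  \<comment> \<open>If no derivative exists, the predicate under \<open>SOME\<close> in
    \<open>deriv\<close> is identically false, so the same constant results for every such
    \<open>\<omega>\<close>. This turns \<open>deriv\<close> into a measurable case distinction on
    the two slopes.\<close>
  have "deriv (f \<omega>) 0 = (if r \<omega> = l \<omega> then r \<omega> else (SOME D. False))" if "\<omega> \<in> space N" for \<omega>
  proof (cases "r \<omega> = l \<omega>")
    case True
    have "\<forall>\<^sub>F t in at 0. f \<omega> t = f \<omega> 0 + r \<omega> * t"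
      using r[OF that] l[OF that] True by (simp add: eventually_at_split)
    then have "deriv (f \<omega>) 0 = r \<omega>"
      by (intro DERIV_imp_deriv aff)
    with True show ?thesis by simp
  next
    case False
    have "\<not> DERIV (f \<omega>) 0 :> D" for D
    proof
      assume "DERIV (f \<omega>) 0 :> D"
      then have *: "(f \<omega> has_real_derivative D) (at 0 within S)" for S
        by (rule has_field_derivative_at_within)
      have "D = r \<omega>"
        using *[of "{0<..}"] aff[OF r[OF that]] unfolding has_field_derivative_iff
        by (rule tendsto_unique[OF trivial_limit_at_right_real])
      moreover have "D = l \<omega>"
        using *[of "{..<0}"] aff[OF l[OF that]] unfolding has_field_derivative_iff
        by (rule tendsto_unique[OF trivial_limit_at_left_real])
      ultimately show False using False by simp
    qed
    with False show ?thesis by (simp add: deriv_def)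
  qed
  then have "(\<lambda>\<omega>. deriv (f \<omega>) 0) \<in> borel_measurable N \<longleftrightarrow>
      (\<lambda>\<omega>. if r \<omega> = l \<omega> then r \<omega> else (SOME D. False)) \<in> borel_measurable N"
    by (intro measurable_cong)
  then show ?thesis by simp
qed

section \<open>Measurability\<close>

lemma space_mat_borel [simp]: "space (mat_borel m k) = carrier_mat m k"
  by (simp add: mat_borel_def)

lemma measurable_mat_borelI:
  assumes "\<And>\<omega>. \<omega> \<in> space N \<Longrightarrow> f \<omega> \<in> carrier_mat m k"
    and "\<And>a b. a < m \<Longrightarrow> b < k \<Longrightarrow> (\<lambda>\<omega>. f \<omega> $$ (a, b)) \<in> borel_measurable N"
  shows "f \<in> measurable N (mat_borel m k)"
  unfolding mat_borel_def
  by (rule measurable_vimage_algebra2) (use assms in \<open>auto intro!: measurable_restrict\<close>)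

lemma measurable_mat_borel_carrier:
  "f \<in> measurable N (mat_borel m k) \<Longrightarrow> \<omega> \<in> space N \<Longrightarrow> f \<omega> \<in> carrier_mat m k"
  by (auto dest: measurable_space)

lemma measurable_mat_borel_entry:
  assumes "f \<in> measurable N (mat_borel m k)" "a < m" "b < k"
  shows "(\<lambda>\<omega>. f \<omega> $$ (a, b)) \<in> borel_measurable N"
proof -
  let ?I = "{..<m} \<times> {..<k}"
  have "(\<lambda>A. restrict (\<lambda>p. A $$ p) ?I) \<in> measurable (mat_borel m k) (PiM ?I (\<lambda>_. borel :: real measure))"
    unfolding mat_borel_def by (rule measurable_vimage_algebra1) (auto simp: space_PiM)
  from measurable_compose[OF assms(1) this]
  have "(\<lambda>\<omega>. restrict (\<lambda>p. f \<omega> $$ p) ?I (a, b)) \<in> borel_measurable N"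
    by (rule measurable_compose) (use assms(2,3) in \<open>auto intro: measurable_component_singleton\<close>)
  with assms(2,3) show ?thesis by simp
qed

lemma measurable_mult_mat:
  assumes f: "f \<in> measurable N (mat_borel p q)" and g: "g \<in> measurable N (mat_borel q r)"
  shows "(\<lambda>\<omega>. f \<omega> * g \<omega>) \<in> measurable N (mat_borel p r)"
proof (rule measurable_mat_borelI)
  fix a b assume ab: "a < p" "b < r"
  have "(\<lambda>\<omega>. \<Sum>c<q. f \<omega> $$ (a, c) * g \<omega> $$ (c, b)) \<in> borel_measurable N"
    by (intro borel_measurable_sum borel_measurable_times measurable_mat_borel_entry[OF f]
        measurable_mat_borel_entry[OF g]) (use ab in auto)
  then show "(\<lambda>\<omega>. (f \<omega> * g \<omega>) $$ (a, b)) \<in> borel_measurable N"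
    by (rule measurable_cong[THEN iffD1, rotated])
       (rule index_mult_mat_sum[symmetric, OF measurable_mat_borel_carrier[OF f]
          measurable_mat_borel_carrier[OF g] ab])
qed (rule mult_carrier_mat[OF measurable_mat_borel_carrier[OF f] measurable_mat_borel_carrier[OF g]])

lemma measurable_mat_diag:
  assumes "\<And>a. a < p \<Longrightarrow> (\<lambda>\<omega>. f \<omega> a) \<in> borel_measurable N"
  shows "(\<lambda>\<omega>. mat_diag p (f \<omega>)) \<in> measurable N (mat_borel p p)"
proof (rule measurable_mat_borelI)
  fix a b assume "a < p" "b < p"
  then show "(\<lambda>\<omega>. mat_diag p (f \<omega>) $$ (a, b)) \<in> borel_measurable N"
    using assms by (cases "a = b") (simp_all add: mat_diag_def)
qed simp

text \<open>A predicate instead of a sigma-algebra on vectors: vectors occur only as intermediate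
  values whose entries are read off, and no law on them is ever formed.\<close>

definition measurable_vec :: "'a measure \<Rightarrow> nat \<Rightarrow> ('a \<Rightarrow> real Matrix.vec) \<Rightarrow> bool" where
  "measurable_vec N m f \<longleftrightarrow> (\<forall>\<omega>\<in>space N. f \<omega> \<in> carrier_vec m) \<and>
     (\<forall>a<m. (\<lambda>\<omega>. f \<omega> $ a) \<in> borel_measurable N)"

lemma measurable_vec_const: "v \<in> carrier_vec m \<Longrightarrow> measurable_vec N m (\<lambda>_. v)"
  by (simp add: measurable_vec_def)

lemma measurable_vec_affine:
  assumes W: "W \<in> measurable N (mat_borel p q)" and v: "measurable_vec N q v"
    and B: "measurable_vec N p B"
  shows "measurable_vec N p (\<lambda>\<omega>. W \<omega> *\<^sub>v v \<omega> + B \<omega>)"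
  unfolding measurable_vec_def
proof safe
  fix \<omega> assume "\<omega> \<in> space N"
  then show "W \<omega> *\<^sub>v v \<omega> + B \<omega> \<in> carrier_vec p"
    using v B mult_mat_vec_carrier[OF measurable_mat_borel_carrier[OF W], of \<omega> "v \<omega>"]
    by (auto simp: measurable_vec_def)
next
  fix a assume a: "a < p"
  have "(\<lambda>\<omega>. (\<Sum>c<q. W \<omega> $$ (a, c) * v \<omega> $ c) + B \<omega> $ a) \<in> borel_measurable N"
    using v B a by (intro borel_measurable_add borel_measurable_sum borel_measurable_times
        measurable_mat_borel_entry[OF W]) (auto simp: measurable_vec_def)
  then show "(\<lambda>\<omega>. (W \<omega> *\<^sub>v v \<omega> + B \<omega>) $ a) \<in> borel_measurable N"
  proof (rule measurable_cong[THEN iffD1, rotated])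
    fix \<omega> assume "\<omega> \<in> space N"
    then show "(\<Sum>c<q. W \<omega> $$ (a, c) * v \<omega> $ c) + B \<omega> $ a = (W \<omega> *\<^sub>v v \<omega> + B \<omega>) $ a"
      using v B a measurable_mat_borel_carrier[OF W]
      by (auto simp: measurable_vec_def index_mult_mat_vec_sum[of _ p q] simp del: index_mult_mat_vec)
  qed
qed

lemma measurable_vec_relu:
  assumes "measurable_vec N m f"
  shows "measurable_vec N m (\<lambda>\<omega>. relu (f \<omega>))"
  unfolding measurable_vec_def
proof safe
  fix a assume a: "a < m"
  have "(\<lambda>\<omega>. max 0 (f \<omega> $ a)) \<in> borel_measurable N"
    using assms a by (auto simp: measurable_vec_def)
  then show "(\<lambda>\<omega>. relu (f \<omega>) $ a) \<in> borel_measurable N"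
    by (rule measurable_cong[THEN iffD1, rotated])
       (use assms a in \<open>auto simp: measurable_vec_def relu_def\<close>)
qed (use assms in \<open>auto simp: measurable_vec_def relu_def\<close>)

lemma measurable_gate:
  assumes "measurable_vec N m f"
  shows "(\<lambda>\<omega>. gate (f \<omega>)) \<in> measurable N (mat_borel m m)"
proof -
  have [measurable]: "(\<lambda>\<omega>. f \<omega> $ a) \<in> borel_measurable N" if "a < m" for a
    using assms that by (auto simp: measurable_vec_def)
  have "(\<lambda>\<omega>. mat_diag m (\<lambda>a. of_bool (0 < f \<omega> $ a))) \<in> measurable N (mat_borel m m)"
    by (rule measurable_mat_diag) (simp add: of_bool_def)
  then show ?thesis
    by (rule measurable_cong[THEN iffD1, rotated])
       (use assms in \<open>auto simp: measurable_vec_def gate_def\<close>)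
qed

lemma measurable_vec_layer_map:
  assumes W: "\<And>i. (\<lambda>\<omega>. W \<omega> i) \<in> measurable N (mat_borel (n i) (n (i - 1)))"
    and B: "\<And>i. measurable_vec N (n i) (\<lambda>\<omega>. B \<omega> i)"
    and "j \<le> k" and y: "measurable_vec N (n j) y"
  shows "measurable_vec N (n k) (\<lambda>\<omega>. layer_map (W \<omega>) (B \<omega>) j k (y \<omega>))"
  using \<open>j \<le> k\<close>
proof (induction k rule: dec_induct)
  case (step k)
  then show ?case
    using W[of "Suc k"] B[of "Suc k"]
    by (simp add: layer_map_Suc measurable_vec_relu measurable_vec_affine)
qed (use y in simp)

lemma measurable_vec_preact:
  assumes W: "\<And>i. (\<lambda>\<omega>. W \<omega> i) \<in> measurable N (mat_borel (n i) (n (i - 1)))"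
    and B: "\<And>i. measurable_vec N (n i) (\<lambda>\<omega>. B \<omega> i)" and x: "x \<in> carrier_vec (n 0)"
  shows "measurable_vec N (n i) (\<lambda>\<omega>. preact (W \<omega>) (B \<omega>) x i)"
  unfolding preact_def
  by (rule measurable_vec_affine[OF W _ B])
    (intro W B measurable_vec_layer_map measurable_vec_const x, simp)

lemma measurable_gated_product:
  assumes W: "\<And>i. (\<lambda>\<omega>. W \<omega> i) \<in> measurable N (mat_borel (n i) (n (i - 1)))"
    and D: "\<And>i. (\<lambda>\<omega>. D \<omega> i) \<in> measurable N (mat_borel (n i) (n i))"
    and "j \<le> k"
  shows "(\<lambda>\<omega>. gated_product n (D \<omega>) (W \<omega>) j k) \<in> measurable N (mat_borel (n k) (n j))"
  using \<open>j \<le> k\<close>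
proof (induction k rule: dec_induct)
  case (step k)
  then show ?case
    using W[of "Suc k"] D[of "Suc k"] by (auto simp: gated_product_Suc intro!: measurable_mult_mat)
qed simp

text \<open>A pushforward by \<open>distr\<close> is meaningful only along a measurable map, so the
  kinks cannot be discarded as a null set here. Each entry is \<open>deriv\<close> at 0 of a
  function of \<open>t\<close> that is affine on either side of 0.\<close>

lemma measurable_Jac:
  assumes W: "\<And>i. (\<lambda>\<omega>. W \<omega> i) \<in> measurable N (mat_borel (n i) (n (i - 1)))"
    and B: "\<And>i. measurable_vec N (n i) (\<lambda>\<omega>. B \<omega> i)"
    and "j \<le> k" and x: "x \<in> carrier_vec (n 0)"
  shows "(\<lambda>\<omega>. Jac n (W \<omega>) (B \<omega>) x j k) \<in> measurable N (mat_borel (n k) (n j))"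
proof (rule measurable_mat_borelI)
  fix a b assume ab: "a < n k" "b < n j"
  define f where "f \<omega> t = layer_map (W \<omega>) (B \<omega>) j k
    (layer_map (W \<omega>) (B \<omega>) 0 j x + t \<cdot>\<^sub>v unit_vec (n j) b) $ a" for \<omega> t
  have y: "measurable_vec N (n j) (\<lambda>\<omega>. layer_map (W \<omega>) (B \<omega>) 0 j x)"
    by (intro measurable_vec_layer_map W B measurable_vec_const x) simp
  have "measurable_vec N (n j) (\<lambda>\<omega>. layer_map (W \<omega>) (B \<omega>) 0 j x + t \<cdot>\<^sub>v unit_vec (n j) b)" for t
    using y unfolding measurable_vec_def by (auto simp: index_add_vec)
  from measurable_vec_layer_map[OF W B \<open>j \<le> k\<close> this]
  have "(\<lambda>\<omega>. f \<omega> t) \<in> borel_measurable N" for t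
    using ab by (auto simp: measurable_vec_def f_def)
  moreover have "\<exists>D. \<forall>\<^sub>F t in F. f \<omega> t = f \<omega> 0 + D * t"
    if \<omega>: "\<omega> \<in> space N" and F: "F = at_left 0 \<or> F = at_right 0" for \<omega> F
  proof -
    have y\<omega>: "layer_map (W \<omega>) (B \<omega>) 0 j x \<in> carrier_vec (n j)"
      using y \<omega> by (auto simp: measurable_vec_def)
    have "f \<omega> 0 = layer_map (W \<omega>) (B \<omega>) j k (layer_map (W \<omega>) (B \<omega>) 0 j x) $ a"
    proof -
      have "layer_map (W \<omega>) (B \<omega>) 0 j x + 0 \<cdot>\<^sub>v unit_vec (n j) b = layer_map (W \<omega>) (B \<omega>) 0 j x"
        using y\<omega> by (intro eq_vecI) auto
      then show ?thesis by (simp add: f_def)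
    qed
    then show ?thesis
      using layer_map_one_sided_affine[where W="W \<omega>" and B="B \<omega>" and n=n,
          OF measurable_mat_borel_carrier[OF W \<omega>] _ \<open>j \<le> k\<close> y\<omega> unit_vec_carrier F, of b] B \<omega> ab(1)
      by (auto simp: f_def measurable_vec_def)
  qed
  ultimately have "(\<lambda>\<omega>. deriv (f \<omega>) 0) \<in> borel_measurable N"
    by (intro measurable_deriv_one_sided_affine) auto
  then show "(\<lambda>\<omega>. Jac n (W \<omega>) (B \<omega>) x j k $$ (a, b)) \<in> borel_measurable N"
    using ab by (simp add: Jac_def jacobian_def f_def[abs_def])
qed (simp add: Jac_def jacobian_def)

section \<open>Product laws and coordinatewise transformations\<close>

lemma measure_two_atoms:
  fixes N :: "real measure"
  assumes "prob_space N" and sets: "sets N = sets borel" and "u \<noteq> w"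
    and uw: "measure N {u} = 1 / 2" "measure N {w} = 1 / 2" and A: "A \<in> sets borel"
  shows "measure N A = (indicator A u + indicator A w) / 2"
proof -
  interpret prob_space N by fact
  have [simp]: "{u} \<in> sets N" "{w} \<in> sets N" "A \<in> sets N" "insert u {w} \<in> sets N"
    using A by (auto simp: sets)
  have uw1: "measure N {u, w} = 1"
  proof -
    have "{u, w} = {u} \<union> {w}" by auto
    then show ?thesis
      using finite_measure_Union[of "{u}" "{w}"] uw \<open>u \<noteq> w\<close> by simp
  qed
  have [simp]: "space N = UNIV"
    using sets_eq_imp_space_eq[OF sets] by simp
  have "measure N (A - {u, w}) \<le> measure N (space N - {u, w})"
    by (intro finite_measure_mono) (auto simp: sets)
  also have "\<dots> = 0"
    using prob_compl[of "{u, w}"] uw1 by simp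
  finally have "measure N (A - {u, w}) = 0"
    by (simp add: measure_le_0_iff)
  then have "measure N A = measure N (A \<inter> {u, w})"
    using finite_measure_Diff'[of A "{u, w}"] by simp
  also have "A \<inter> {u, w} = (if u \<in> A then {u} else {}) \<union> (if w \<in> A then {w} else {})"
    by auto
  also have "measure N \<dots> = (indicator A u + indicator A w) / 2"
    using uw1 uw by (cases "u \<in> A"; cases "w \<in> A") (simp_all add: insert_commute)
  finally show ?thesis .
qed

text \<open>As an image of a fair coin, its images under measurable maps are again of this
  form.\<close>

definition two_point :: "real \<Rightarrow> real \<Rightarrow> real measure" where
  "two_point u w = distr (measure_pmf (bernoulli_pmf (1 / 2))) borel (\<lambda>b. if b then u else w)"

lemma sets_two_point [simp]: "sets (two_point u w) = sets borel"
  by (simp add: two_point_def)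

lemma prob_space_two_point: "prob_space (two_point u w)"
  unfolding two_point_def by (intro prob_space.prob_space_distr measure_pmf.prob_space_axioms) simp

lemma measure_two_point:
  assumes "u \<noteq> w"
  shows "measure (two_point u w) {u} = 1 / 2" "measure (two_point u w) {w} = 1 / 2"
proof -
  have "(\<lambda>b. if b then u else w) -` {u} = {True}" "(\<lambda>b. if b then u else w) -` {w} = {False}"
    using \<open>u \<noteq> w\<close> by (auto split: if_splits)
  then show "measure (two_point u w) {u} = 1 / 2" "measure (two_point u w) {w} = 1 / 2"
    by (simp_all add: two_point_def measure_distr measure_pmf_single)
qed

text \<open>Two atoms of mass 1/2 exhaust a probability measure. This turns the point masses given
  for signs and masks into an identification of their laws.\<close>

lemma eq_two_point:
  assumes "prob_space N" and sets: "sets N = sets borel" and "u \<noteq> w"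
    and uw: "measure N {u} = 1 / 2" "measure N {w} = 1 / 2"
  shows "N = two_point u w"
proof (rule measure_eqI)
  fix A assume "A \<in> sets N"
  then have A: "A \<in> sets borel" by (simp add: sets)
  interpret N: prob_space N by fact
  interpret T: prob_space "two_point u w" by (rule prob_space_two_point)
  have "measure N A = measure (two_point u w) A"
    unfolding measure_two_atoms[OF assms A]
      measure_two_atoms[OF prob_space_two_point sets_two_point \<open>u \<noteq> w\<close> measure_two_point[OF \<open>u \<noteq> w\<close>] A] ..
  then show "emeasure N A = emeasure (two_point u w) A"
    unfolding N.emeasure_eq_measure T.emeasure_eq_measure by simp
qed (simp add: sets)

text \<open>Needed when a preactivation is not positive: the fair 0/1 coin is then mapped to a sign
  with the roles of 1 and - 1 exchanged.\<close>

lemma two_point_commute: "two_point u w = two_point w u"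
proof (cases "u = w")
  case False
  then show ?thesis
    by (intro eq_two_point prob_space_two_point sets_two_point measure_two_point) auto
qed simp

lemma distr_two_point:
  assumes "g \<in> borel_measurable borel"
  shows "distr (two_point u w) borel g = two_point (g u) (g w)"
proof -
  have "g \<circ> (\<lambda>b. if b then u else w) = (\<lambda>b. if b then g u else g w)"
    by auto
  then show ?thesis
    using assms by (simp add: two_point_def distr_distr)
qed

lemma AE_two_point: "AE t in two_point u w. t = u \<or> t = w"
  unfolding two_point_def by (subst AE_distr_iff) auto

section \<open>Coordinate laws and the matrices assembled from coordinates\<close>

primrec law :: "real measure \<Rightarrow> real measure \<Rightarrow> coord \<Rightarrow> real measure" where
  "law \<mu> \<nu> (Weight i a b) = \<mu>"
| "law \<mu> \<nu> (Bias i a) = \<nu>"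
| "law \<mu> \<nu> (Sign a) = two_point 1 (- 1)"
| "law \<mu> \<nu> (Mask i a) = two_point 1 0"

text \<open>Symmetry is put as invariance under multiplication by either sign, the form in which
  rows and columns of the weights are flipped.\<close>

lemma admissible_law:
  assumes "admissible \<mu>"
  shows admissible_prob_space: "prob_space \<mu>"
    and admissible_sets: "sets \<mu> = sets borel"
    and admissible_scale: "\<And>s. s = 1 \<or> s = - 1 \<Longrightarrow> distr \<mu> borel (\<lambda>t. s * t) = \<mu>"
    and admissible_singleton: "measure \<mu> {y} = 0"
proof -
  from assms interpret real_distribution \<mu>
    by (simp add: admissible_def)
  show "prob_space \<mu>" "sets \<mu> = sets borel" by unfold_locales simp
  show "distr \<mu> borel (\<lambda>t. s * t) = \<mu>" if "s = 1 \<or> s = - 1" for s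
    using that
  proof
    assume "s = 1"
    then show ?thesis by (simp add: distr_id2)
  next
    assume "s = - 1"
    then show ?thesis using assms by (simp add: admissible_def)
  qed
  show "measure \<mu> {y} = 0" using assms by (simp add: admissible_def)
qed

definition weight_mat :: "(nat \<Rightarrow> nat) \<Rightarrow> (coord \<Rightarrow> real) \<Rightarrow> nat \<Rightarrow> real Matrix.mat" where
  "weight_mat n z i = Matrix.mat (n i) (n (i - 1)) (\<lambda>(a, b). z (Weight i a b))"

definition bias_vec :: "(nat \<Rightarrow> nat) \<Rightarrow> (coord \<Rightarrow> real) \<Rightarrow> nat \<Rightarrow> real Matrix.vec" where
  "bias_vec n z i = Matrix.vec (n i) (\<lambda>a. z (Bias i a))"

definition mask_mat :: "(nat \<Rightarrow> nat) \<Rightarrow> (coord \<Rightarrow> real) \<Rightarrow> nat \<Rightarrow> real Matrix.mat" where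
  "mask_mat n z i = mat_diag (n i) (\<lambda>a. z (Mask i a))"

definition sign_mat :: "nat \<Rightarrow> (coord \<Rightarrow> real) \<Rightarrow> real Matrix.mat" where
  "sign_mat m z = mat_diag m (\<lambda>a. z (Sign a))"

lemma coord_matrices_carrier [simp]:
  "weight_mat n z i \<in> carrier_mat (n i) (n (i - 1))"
  "bias_vec n z i \<in> carrier_vec (n i)"
  "mask_mat n z i \<in> carrier_mat (n i) (n i)"
  "sign_mat m z \<in> carrier_mat m m"
  by (simp_all add: weight_mat_def bias_vec_def mask_mat_def sign_mat_def)

lemma weight_mat_cong:
  "(\<And>a b. a < n i \<Longrightarrow> b < n (i - 1) \<Longrightarrow> z (Weight i a b) = z' (Weight i a b)) \<Longrightarrow>
    weight_mat n z i = weight_mat n z' i"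
  by (auto simp: weight_mat_def)

lemma bias_vec_cong:
  "(\<And>a. a < n i \<Longrightarrow> z (Bias i a) = z' (Bias i a)) \<Longrightarrow> bias_vec n z i = bias_vec n z' i"
  by (auto simp: bias_vec_def)

lemma mask_mat_cong:
  "(\<And>a. a < n i \<Longrightarrow> z (Mask i a) = z' (Mask i a)) \<Longrightarrow> mask_mat n z i = mask_mat n z' i"
  by (auto simp: mask_mat_def mat_diag_def)

lemma sign_mat_cong:
  "(\<And>a. a < m \<Longrightarrow> z (Sign a) = z' (Sign a)) \<Longrightarrow> sign_mat m z = sign_mat m z'"
  by (auto simp: sign_mat_def mat_diag_def)

definition weight_layer :: "(nat \<Rightarrow> nat) \<Rightarrow> nat \<Rightarrow> coord set" where
  "weight_layer n i = {Weight i a b | a b. a < n i \<and> b < n (i - 1)}"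

definition bias_layer :: "(nat \<Rightarrow> nat) \<Rightarrow> nat \<Rightarrow> coord set" where
  "bias_layer n i = {Bias i a | a. a < n i}"

definition mask_layer :: "(nat \<Rightarrow> nat) \<Rightarrow> nat \<Rightarrow> coord set" where
  "mask_layer n i = {Mask i a | a. a < n i}"

lemma weight_coords_eq: "weight_coords n k = (\<Union>i\<in>{1..k}. weight_layer n i)"
  by (auto simp: weight_coords_def weight_layer_def)

lemma bias_coords_eq: "bias_coords n k = (\<Union>i\<in>{1..k}. bias_layer n i)"
  by (auto simp: bias_coords_def bias_layer_def)

lemma mask_coords_eq: "mask_coords n j k = (\<Union>i\<in>{j<..k}. mask_layer n i)"
  by (auto simp: mask_coords_def mask_layer_def)

lemma finite_layers [simp]:
  "finite (weight_layer n i)" "finite (bias_layer n i)" "finite (mask_layer n i)"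
  "finite (sign_coords m)"
proof -
  have "weight_layer n i = (\<lambda>(a, b). Weight i a b) ` ({..<n i} \<times> {..<n (i - 1)})"
    "bias_layer n i = Bias i ` {..<n i}" "mask_layer n i = Mask i ` {..<n i}"
    "sign_coords m = Sign ` {..<m}"
    by (auto simp: weight_layer_def bias_layer_def mask_layer_def sign_coords_def)
  then show "finite (weight_layer n i)" "finite (bias_layer n i)" "finite (mask_layer n i)"
    "finite (sign_coords m)"
    by simp_all
qed

lemma finite_coords [simp]:
  "finite (weight_coords n k)" "finite (bias_coords n k)" "finite (mask_coords n j k)"
  by (simp_all add: weight_coords_eq bias_coords_eq mask_coords_eq)

text \<open>An injective reindexing keeps the coordinates independent, and the preimage of a box
  under a coordinatewise map is a box. Hence both measures agree on boxes, which determine a finite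
  product measure.\<close>

lemma distr_PiM_coordinatewise:
  assumes "finite J" and \<pi>: "\<pi> \<in> J \<rightarrow> I" "inj_on \<pi> J"
    and L: "\<And>c. prob_space (L c)" and L': "\<And>c. prob_space (L' c)"
    and g: "\<And>c. c \<in> J \<Longrightarrow> g c \<in> measurable (L (\<pi> c)) (L' c)"
    and distr: "\<And>c. c \<in> J \<Longrightarrow> distr (L (\<pi> c)) (L' c) (g c) = L' c"
  shows "distr (PiM I L) (PiM J L') (\<lambda>z. \<lambda>c\<in>J. g c (z (\<pi> c))) = PiM J L'"
proof -
  interpret P: product_prob_space "\<lambda>c. L (\<pi> c)" J
    by (intro product_prob_spaceI L)
  interpret Q: product_prob_space L' J
    by (intro product_prob_spaceI L')
  define S where "S = PiM J (\<lambda>c. L (\<pi> c))"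
  define T where "T z = (\<lambda>c\<in>J. g c (z c))" for z
  have T: "T \<in> measurable S (PiM J L')"
    unfolding S_def T_def[abs_def] using g
    by (intro measurable_restrict measurable_compose[OF measurable_component_singleton]) auto
  have "distr S (PiM J L') T = PiM J L'"
  proof (rule Q.PiM_eqI[OF \<open>finite J\<close>])
    fix A assume A: "\<And>c. c \<in> J \<Longrightarrow> A c \<in> sets (L' c)"
    have vim: "g c -` A c \<inter> space (L (\<pi> c)) \<in> sets (L (\<pi> c))" if "c \<in> J" for c
      using g[OF that] A[OF that] by (rule measurable_sets)
    have "T -` Pi\<^sub>E J A \<inter> space S = (\<Pi>\<^sub>E c\<in>J. g c -` A c \<inter> space (L (\<pi> c)))"
      by (auto simp: T_def S_def space_PiM PiE_iff extensional_def)
    then have "emeasure (distr S (PiM J L') T) (Pi\<^sub>E J A) =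
        (\<Prod>c\<in>J. emeasure (L (\<pi> c)) (g c -` A c \<inter> space (L (\<pi> c))))"
      using T A \<open>finite J\<close> vim
      by (simp add: emeasure_distr sets_PiM_I_finite S_def P.emeasure_PiM)
    also have "\<dots> = (\<Prod>c\<in>J. emeasure (L' c) (A c))"
    proof (rule prod.cong[OF refl])
      fix c assume c: "c \<in> J"
      show "emeasure (L (\<pi> c)) (g c -` A c \<inter> space (L (\<pi> c))) = emeasure (L' c) (A c)"
        using emeasure_distr[OF g[OF c] A[OF c]] distr[OF c] by simp
    qed
    finally show "emeasure (distr S (PiM J L') T) (Pi\<^sub>E J A) = (\<Prod>c\<in>J. emeasure (L' c) (A c))" .
  qed simp
  moreover have "distr (PiM I L) S (\<lambda>z. \<lambda>c\<in>J. z (\<pi> c)) = S"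
    unfolding S_def using L \<pi> by (intro distr_PiM_reindex) auto
  ultimately have "PiM J L' = distr (distr (PiM I L) S (\<lambda>z. \<lambda>c\<in>J. z (\<pi> c))) (PiM J L') T"
    by simp
  also have "\<dots> = distr (PiM I L) (PiM J L') (T \<circ> (\<lambda>z. \<lambda>c\<in>J. z (\<pi> c)))"
    using \<pi> by (intro distr_distr T)
      (auto simp: S_def intro!: measurable_restrict measurable_component_singleton)
  also have "T \<circ> (\<lambda>z. \<lambda>c\<in>J. z (\<pi> c)) = (\<lambda>z. \<lambda>c\<in>J. g c (z (\<pi> c)))"
    by (auto simp: T_def fun_eq_iff)
  finally show ?thesis ..
qed

locale net_laws =
  fixes \<mu> \<nu> :: "real measure"
  assumes \<mu>: "admissible \<mu>" and \<nu>: "admissible \<nu>"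
begin

abbreviation L :: "coord \<Rightarrow> real measure" where "L \<equiv> law \<mu> \<nu>"

lemma prob_space_law: "prob_space (L c)"
  by (cases c) (auto simp: admissible_prob_space \<mu> \<nu> prob_space_two_point)

lemma sets_law [measurable_cong]: "sets (L c) = sets borel"
  by (cases c) (auto simp: admissible_sets \<mu> \<nu>)

lemma space_law [simp]: "space (L c) = UNIV"
  using sets_eq_imp_space_eq[OF sets_law] by simp

lemma measurable_law: "measurable N (L c) = borel_measurable N" "measurable (L c) N = measurable borel N"
  by (rule measurable_cong_sets[OF refl sets_law], rule measurable_cong_sets[OF sets_law refl])

sublocale product_prob_space L UNIV
  by (intro product_prob_spaceI prob_space_law)

lemma prob_space_PiM_law: "prob_space (PiM I L)"
  by (intro prob_space_PiM prob_space_law)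

text \<open>Off \<open>I\<close> every point of the product space takes the constant value
  \<open>undefined\<close>. The matrices built from coordinates are thus measurable over every index
  set.\<close>

lemma measurable_coord [measurable]: "(\<lambda>z. z c) \<in> borel_measurable (PiM I L)"
proof (cases "c \<in> I")
  case True
  then show ?thesis
    using measurable_component_singleton[of c I L] by (simp add: measurable_law)
next
  case False
  then have "(\<lambda>z. z c) \<in> borel_measurable (PiM I L) \<longleftrightarrow>
      (\<lambda>z. undefined :: real) \<in> borel_measurable (PiM I L)"
    by (intro measurable_cong) (simp add: space_PiM PiE_def extensional_def)
  then show ?thesis by simp
qed

lemma measurable_coord_matrices [measurable]:
  "(\<lambda>z. weight_mat n z i) \<in> measurable (PiM I L) (mat_borel (n i) (n (i - 1)))"
  "(\<lambda>z. mask_mat n z i) \<in> measurable (PiM I L) (mat_borel (n i) (n i))"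
  "(\<lambda>z. sign_mat m z) \<in> measurable (PiM I L) (mat_borel m m)"
proof -
  show "(\<lambda>z. weight_mat n z i) \<in> measurable (PiM I L) (mat_borel (n i) (n (i - 1)))"
    by (rule measurable_mat_borelI) (simp_all add: weight_mat_def)
  show "(\<lambda>z. mask_mat n z i) \<in> measurable (PiM I L) (mat_borel (n i) (n i))"
    "(\<lambda>z. sign_mat m z) \<in> measurable (PiM I L) (mat_borel m m)"
    by (simp_all add: mask_mat_def sign_mat_def measurable_mat_diag)
qed

lemma measurable_bias_vec: "measurable_vec (PiM I L) (n i) (\<lambda>z. bias_vec n z i)"
  by (simp add: measurable_vec_def bias_vec_def)

lemma nn_integral_coordinatewise:
  assumes "finite J" "\<pi> \<in> J \<rightarrow> I" "inj_on \<pi> J"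
    and g: "\<And>c. c \<in> J \<Longrightarrow> g c \<in> borel_measurable borel"
    and distr: "\<And>c. c \<in> J \<Longrightarrow> distr (L (\<pi> c)) borel (g c) = L c"
    and f: "f \<in> borel_measurable (PiM J L)"
  shows "(\<integral>\<^sup>+z. f (\<lambda>c\<in>J. g c (z (\<pi> c))) \<partial>PiM I L) = (\<integral>\<^sup>+z. f z \<partial>PiM J L)"
proof -
  have g': "g c \<in> measurable (L (\<pi> c)) (L c)" if "c \<in> J" for c
    using g[OF that] by (simp add: measurable_law)
  have distr': "distr (L (\<pi> c)) (L c) (g c) = L c" if "c \<in> J" for c
    using distr[OF that] distr_cong[OF refl sets_law, of "L (\<pi> c)" "g c" "g c" c] by simp
  let ?T = "\<lambda>z. \<lambda>c\<in>J. g c (z (\<pi> c))"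
  have T: "?T \<in> measurable (PiM I L) (PiM J L)"
  proof (rule measurable_restrict)
    fix c assume c: "c \<in> J"
    with assms(2) have "\<pi> c \<in> I" by auto
    from measurable_compose[OF measurable_component_singleton[of "\<pi> c" I L, OF this] g'[OF c]]
    show "(\<lambda>z. g c (z (\<pi> c))) \<in> measurable (PiM I L) (L c)" .
  qed
  have "(\<integral>\<^sup>+z. f z \<partial>PiM J L) = (\<integral>\<^sup>+z. f z \<partial>distr (PiM I L) (PiM J L) ?T)"
    using distr_PiM_coordinatewise[where L = L and L' = L and g = g and \<pi> = \<pi> and I = I, OF assms(1-3) prob_space_law prob_space_law g' distr'] by simp
  also have "\<dots> = (\<integral>\<^sup>+z. f (?T z) \<partial>PiM I L)"
    using T f by (subst nn_integral_distr) simp_all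
  finally show ?thesis ..
qed

text \<open>The identity as coordinatewise map: coordinates that the integrand does not read are
  integrated out. It serves both to drop biases and to adjoin signs.\<close>

lemma nn_integral_marginal:
  assumes "finite J" "J \<subseteq> I" and f: "f \<in> borel_measurable (PiM J L)"
    and cong: "\<And>z. f (restrict z J) = f z"
  shows "(\<integral>\<^sup>+z. f z \<partial>PiM I L) = (\<integral>\<^sup>+z. f z \<partial>PiM J L)"
proof -
  have "distr (L c) borel (\<lambda>t. t) = L c" for c
    using distr_id2[of borel "L c"] sets_law[of c] by simp
  with nn_integral_coordinatewise[of J "\<lambda>c. c" I "\<lambda>c t. t" f] assms show ?thesis
    by (auto simp: cong)
qed

text \<open>The coordinates in \<^term>\<open>J\<close> are transformed by maps that may depend on those in
  \<^term>\<open>I\<close> but that preserve the laws for every fixed value of the latter.\<close>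

lemma nn_integral_triangular:
  assumes I: "finite I" "finite J" "finite J'" "I \<inter> J = {}" "I \<inter> J' = {}"
    and \<pi>: "\<pi> \<in> J \<rightarrow> J'" "inj_on \<pi> J"
    and g: "\<And>z c. c \<in> J \<Longrightarrow> g z c \<in> borel_measurable borel"
    and distr: "\<And>z c. c \<in> J \<Longrightarrow> distr (L (\<pi> c)) borel (g z c) = L c"
    and cong: "\<And>z z' c. c \<in> J \<Longrightarrow> (\<And>d. d \<in> I \<Longrightarrow> z d = z' d) \<Longrightarrow> g z c = g z' c"
    and meas: "\<And>c. c \<in> J \<Longrightarrow> (\<lambda>z. g z c (z (\<pi> c))) \<in> borel_measurable (PiM (I \<union> J') L)"
    and f: "f \<in> borel_measurable (PiM (I \<union> J) L)"
  defines "T \<equiv> \<lambda>z. \<lambda>c\<in>I \<union> J. if c \<in> J then g z c (z (\<pi> c)) else z c"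
  shows "(\<integral>\<^sup>+z. f z \<partial>PiM (I \<union> J) L) = (\<integral>\<^sup>+z. f (T z) \<partial>PiM (I \<union> J') L)"
proof -
  have T: "T \<in> measurable (PiM (I \<union> J') L) (PiM (I \<union> J) L)"
    unfolding T_def
  proof (rule measurable_restrict)
    fix c assume c: "c \<in> I \<union> J"
    have "(\<lambda>z. if c \<in> J then g z c (z (\<pi> c)) else z c) \<in> borel_measurable (PiM (I \<union> J') L)"
      using meas c by (cases "c \<in> J") simp_all
    then show "(\<lambda>z. if c \<in> J then g z c (z (\<pi> c)) else z c) \<in> measurable (PiM (I \<union> J') L) (L c)"
      by (simp add: measurable_law)
  qed
  \<comment> \<open>By Fubini it is enough to compare inner integrals for a fixed \<open>x\<close>.
    The maps \<open>g x\<close> are then fixed too, so the coordinatewise change of variables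
    applies.\<close>
  have "(\<integral>\<^sup>+w. f (merge I J (x, w)) \<partial>PiM J L) = (\<integral>\<^sup>+w. f (T (merge I J' (x, w))) \<partial>PiM J' L)"
    if x: "x \<in> space (PiM I L)" for x
  proof -
    have "(\<lambda>w. f (merge I J (x, w))) \<in> borel_measurable (PiM J L)"
      using x by (intro measurable_compose[OF _ f] measurable_compose[OF _ measurable_merge]) simp
    from nn_integral_coordinatewise[of J \<pi> J' "g x", OF I(2) \<pi> g distr this]
    have "(\<integral>\<^sup>+w. f (merge I J (x, w)) \<partial>PiM J L) =
        (\<integral>\<^sup>+w. f (merge I J (x, \<lambda>c\<in>J. g x c (w (\<pi> c)))) \<partial>PiM J' L)"
      by simp
    also have "\<dots> = (\<integral>\<^sup>+w. f (T (merge I J' (x, w))) \<partial>PiM J' L)"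
    proof (intro nn_integral_cong arg_cong[where f = f] ext)
      fix w c
      have "g (merge I J' (x, w)) c = g x c" if "c \<in> J"
        using that by (rule cong) (simp add: merge_def)
      moreover have "merge I J' (x, w) (\<pi> c) = w (\<pi> c)" if "c \<in> J"
        using \<pi>(1) I(5) that by (auto simp: merge_def)
      ultimately show "merge I J (x, \<lambda>c\<in>J. g x c (w (\<pi> c))) c = T (merge I J' (x, w)) c"
        using I(4) by (auto simp: T_def merge_def)
    qed
    finally show ?thesis .
  qed
  then show ?thesis
    unfolding product_nn_integral_fold[OF I(4,1,2) f]
      product_nn_integral_fold[OF I(5,1,3) measurable_compose[OF T f]]
    by (rule nn_integral_cong)
qed

text \<open>With all other coordinates fixed, the sum vanishes only when \<open>z c\<close> equals
  the fixed number \<open>- r z\<close>, and the law of coordinate \<open>c\<close> has no atom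
  there.\<close>

lemma AE_add_coord_nonzero:
  assumes "finite I" "c \<in> I" and r: "r \<in> borel_measurable (PiM I L)"
    and indep: "\<And>z t. r (z(c := t)) = r z" and atomless: "\<And>y. measure (L c) {y} = 0"
  shows "AE z in PiM I L. r z + z c \<noteq> 0"
proof -
  define f :: "(coord \<Rightarrow> real) \<Rightarrow> ennreal" where "f z = indicator {0} (r z + z c)" for z
  have f: "f \<in> borel_measurable (PiM I L)"
    unfolding f_def[abs_def] using r by measurable
  have I: "insert c (I - {c}) = I" using \<open>c \<in> I\<close> by auto
  have "(\<integral>\<^sup>+z. f z \<partial>PiM I L) = (\<integral>\<^sup>+x. \<integral>\<^sup>+y. f (x(c := y)) \<partial>L c \<partial>PiM (I - {c}) L)"
    using product_nn_integral_insert[of "I - {c}" c f] f \<open>finite I\<close>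
    unfolding I by simp
  also have "\<dots> = (\<integral>\<^sup>+x. 0 \<partial>PiM (I - {c}) L)"
  proof (rule nn_integral_cong)
    fix x
    have "(\<integral>\<^sup>+y. f (x(c := y)) \<partial>L c) = (\<integral>\<^sup>+y. indicator {- r x} y \<partial>L c)"
      by (intro nn_integral_cong) (auto simp: f_def indep indicator_def)
    also have "\<dots> = 0"
      using atomless[of "- r x"] by (simp add: sets_law M.emeasure_eq_measure)
    finally show "(\<integral>\<^sup>+y. f (x(c := y)) \<partial>L c) = 0" .
  qed
  finally have "AE z in PiM I L. f z = 0"
    using f by (simp add: nn_integral_0_iff_AE)
  then show ?thesis
    by eventually_elim (auto simp: f_def indicator_def split: if_splits)
qed

end

section \<open>Induction on the layers\<close>

lemma mat_diag_cong: "(\<And>a. a < p \<Longrightarrow> f a = g a) \<Longrightarrow> mat_diag p f = mat_diag p g"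
  by (auto simp: mat_diag_def)

text \<open>Row by row, diagonal factors are scalars that commute. The outer \<open>\<xi>\<close> is
  to be the random signs, \<open>\<gamma>\<close> the gate, the inner \<open>\<xi>\<close> the
  flipping of the weights, and \<open>m\<close> the resulting mask.\<close>

lemma mat_diag_sandwich:
  assumes "W \<in> carrier_mat p q" "P \<in> carrier_mat q r"
    and "\<And>a. a < p \<Longrightarrow> \<xi> a * \<gamma> a * \<xi> a = m a"
  shows "mat_diag p \<xi> * (mat_diag p \<gamma> * (mat_diag p \<xi> * W) * P) = mat_diag p m * W * P"
proof (rule eq_matI)
  have c: "mat_diag p \<xi> * W \<in> carrier_mat p q" "mat_diag p \<gamma> * (mat_diag p \<xi> * W) \<in> carrier_mat p q"
    "mat_diag p m * W \<in> carrier_mat p q" "mat_diag p \<gamma> * (mat_diag p \<xi> * W) * P \<in> carrier_mat p r"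
    using assms(1,2) by (meson mult_carrier_mat mat_diag_dim)+
  show "dim_row (mat_diag p \<xi> * (mat_diag p \<gamma> * (mat_diag p \<xi> * W) * P)) = dim_row (mat_diag p m * W * P)"
    "dim_col (mat_diag p \<xi> * (mat_diag p \<gamma> * (mat_diag p \<xi> * W) * P)) = dim_col (mat_diag p m * W * P)"
    using assms(1,2) by (simp_all add: mat_diag_def)
  fix a b
  assume "a < dim_row (mat_diag p m * W * P)" "b < dim_col (mat_diag p m * W * P)"
  then have ab: "a < p" "b < r" using assms(1,2) by (auto simp: mat_diag_def)
  show "(mat_diag p \<xi> * (mat_diag p \<gamma> * (mat_diag p \<xi> * W) * P)) $$ (a, b) = (mat_diag p m * W * P) $$ (a, b)"
    using assms(1) ab
    by (simp add: index_mat_diag_mult[OF c(4)] index_mult_mat_sum[OF c(2) assms(2)]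
        index_mult_mat_sum[OF c(3) assms(2)] index_mat_diag_mult[OF c(1)]
        index_mat_diag_mult[OF assms(1)] sum_distrib_left assms(3)[symmetric] mult.assoc
        del: index_mult_mat)
qed

context net_laws
begin

lemma measurable_masked_layer:
  assumes "P \<in> carrier_mat (n (i - 1)) r"
  shows "(\<lambda>z. mask_mat n z i * weight_mat n z i * P) \<in> measurable (PiM I L) (mat_borel (n i) r)"
  using assms
  by (intro measurable_mult_mat[OF measurable_mult_mat[OF measurable_coord_matrices(2)
        measurable_coord_matrices(1)]] measurable_const) simp

text \<open>Given the input \<^term>\<open>v\<close> of the layer, multiply row \<^term>\<open>a\<close> of the weights and biases
  by a sign \<^term>\<open>\<xi> a\<close>.  The gate at \<^term>\<open>a\<close> is then open iff \<^term>\<open>\<xi> a\<close> is the sign of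
  the preactivation, so that it becomes a fair coin independent of the weights, while the two
  remaining factors \<^term>\<open>\<xi> a\<close> cancel.\<close>

lemma layer_step:
  fixes n :: "nat \<Rightarrow> nat" and i r :: nat
  assumes v: "v \<in> carrier_vec (n (i - 1))" and P: "P \<in> carrier_mat (n (i - 1)) r"
    and \<phi>: "\<phi> \<in> borel_measurable (mat_borel (n i) r)"
  shows "(\<integral>\<^sup>+z. \<phi> (sign_mat (n i) z *
        (gate (weight_mat n z i *\<^sub>v v + bias_vec n z i) * weight_mat n z i * P))
      \<partial>PiM (weight_layer n i \<union> bias_layer n i \<union> sign_coords (n i)) L) =
    (\<integral>\<^sup>+z. \<phi> (mask_mat n z i * weight_mat n z i * P) \<partial>PiM (weight_layer n i \<union> mask_layer n i) L)"
proof -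
  let ?WB = "weight_layer n i \<union> bias_layer n i" and ?S = "sign_coords (n i)" and ?M = "mask_layer n i"
  define act where "act z = weight_mat n z i *\<^sub>v v + bias_vec n z i" for z
  have act_index: "act z $ a = (\<Sum>c<n (i - 1). z (Weight i a c) * v $ c) + z (Bias i a)" if "a < n i" for z a
    using that v unfolding act_def
    by (simp add: index_mult_mat_vec_sum[of _ "n i" "n (i - 1)"] bias_vec_def weight_mat_def
        del: index_mult_mat_vec)
  have act_carrier: "act z \<in> carrier_vec (n i)" for z
    unfolding act_def by (intro add_carrier_vec mult_mat_vec_carrier[OF _ v] coord_matrices_carrier)
  define F where "F z = \<phi> (sign_mat (n i) z * (gate (act z) * weight_mat n z i * P))" for z
  have act_measurable: "measurable_vec (PiM I L) (n i) act" for I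
    unfolding act_def[abs_def]
    by (rule measurable_vec_affine[OF measurable_coord_matrices(1)[where n = n and i = i]
          measurable_vec_const[OF v] measurable_bias_vec[where n = n and i = i]])
  have const: "(\<lambda>_. P) \<in> measurable (PiM I L) (mat_borel (n (i - 1)) r)" for I
    using P by (intro measurable_const) simp
  have F: "F \<in> borel_measurable (PiM I L)" for I
    unfolding F_def[abs_def]
    by (rule measurable_compose[OF measurable_mult_mat[OF measurable_coord_matrices(3)
          measurable_mult_mat[OF measurable_mult_mat[OF measurable_gate[OF act_measurable]
              measurable_coord_matrices(1)[where n = n and i = i]] const]] \<phi>])
  \<comment> \<open>Sign coordinates are only almost surely 1 or - 1. Rounding them makes the flip
    law-preserving for every fixed value of the signs, as \<open>nn_integral_triangular\<close>
    demands.\<close>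
  define sg :: "real \<Rightarrow> real" where "sg t = (if t = 1 then 1 else - 1)" for t
  have sg: "sg t = 1 \<or> sg t = - 1" for t by (simp add: sg_def)
  have [measurable]: "sg \<in> borel_measurable borel"
    unfolding sg_def[abs_def] by measurable
  define flip :: "(coord \<Rightarrow> real) \<Rightarrow> coord \<Rightarrow> real \<Rightarrow> real" where
    "flip z c t = (case c of Weight _ a _ \<Rightarrow> sg (z (Sign a)) * t | Bias _ a \<Rightarrow> sg (z (Sign a)) * t | _ \<Rightarrow> t)"
    for z c t
  have flip_measurable: "(\<lambda>z. flip z c (z c)) \<in> borel_measurable (PiM I L)" for c I
    unfolding flip_def[abs_def] by (cases c) simp_all
  define T1 where "T1 z = (\<lambda>c\<in>?S \<union> ?WB. if c \<in> ?WB then flip z c (z c) else z c)" for z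
  \<comment> \<open>First change of variables: the signs are the parameters, and the weights and
    biases are flipped by symmetry of \<open>\<mu>\<close> and \<open>\<nu>\<close>.\<close>
  have 1: "(\<integral>\<^sup>+z. F z \<partial>PiM (?S \<union> ?WB) L) = (\<integral>\<^sup>+z. F (T1 z) \<partial>PiM (?S \<union> ?WB) L)"
    unfolding T1_def
  proof (rule nn_integral_triangular[where \<pi> = "\<lambda>c. c" and g = flip])
    fix z c assume "c \<in> ?WB"
    then consider a b where "c = Weight i a b" | a where "c = Bias i a"
      by (auto simp: weight_layer_def bias_layer_def)
    then show "distr (L c) borel (flip z c) = L c"
      by cases (simp_all add: flip_def[abs_def] admissible_scale[OF \<mu> sg] admissible_scale[OF \<nu> sg])
  next
    fix z z' :: "coord \<Rightarrow> real" and c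
    assume "c \<in> ?WB" and eq: "\<And>d. d \<in> ?S \<Longrightarrow> z d = z' d"
    then obtain a where "a < n i" "(\<exists>b. c = Weight i a b) \<or> c = Bias i a"
      by (auto simp: weight_layer_def bias_layer_def)
    moreover from \<open>a < n i\<close> have "z (Sign a) = z' (Sign a)"
      by (intro eq) (auto simp: sign_coords_def)
    ultimately show "flip z c = flip z' c"
      by (auto simp: flip_def)
  next
    fix z c show "flip z c \<in> borel_measurable borel"
      unfolding flip_def[abs_def] by (cases c) simp_all
  next
    fix c show "(\<lambda>z. flip z c (z c)) \<in> borel_measurable (PiM (?S \<union> ?WB) L)"
      by (rule flip_measurable)
  qed (simp_all add: F, auto simp: sign_coords_def weight_layer_def bias_layer_def)
  define sa :: "(coord \<Rightarrow> real) \<Rightarrow> nat \<Rightarrow> real" where "sa z a = (if 0 < act z $ a then 1 else - 1)" for z a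
  \<comment> \<open>A sign is produced from a mask: mask 1 gives the sign of the preactivation, any
    other value the opposite one. For fixed weights and biases a fair 0/1 coin becomes a fair
    sign.\<close>
  define coin :: "(coord \<Rightarrow> real) \<Rightarrow> coord \<Rightarrow> real \<Rightarrow> real" where
    "coin z c t = (case c of Sign a \<Rightarrow> if t = 1 then sa z a else - sa z a | _ \<Rightarrow> t)" for z c t
  define \<pi> where "\<pi> c = (case c of Sign a \<Rightarrow> Mask i a | _ \<Rightarrow> c)" for c
  define T2 where "T2 z = (\<lambda>c\<in>?WB \<union> ?S. if c \<in> ?S then coin z c (z (\<pi> c)) else z c)" for z
  have T1: "T1 \<in> measurable (PiM (?WB \<union> ?S) L) (PiM (?S \<union> ?WB) L)"
    unfolding T1_def[abs_def]
  proof (rule measurable_restrict)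
    fix c show "(\<lambda>z. if c \<in> ?WB then flip z c (z c) else z c) \<in> measurable (PiM (?WB \<union> ?S) L) (L c)"
      unfolding measurable_law by (cases "c \<in> ?WB") (simp_all add: flip_measurable)
  qed
  \<comment> \<open>Second change of variables, with the roles exchanged: weights and biases are the
    parameters, and the sign coordinates are replaced by mask coordinates through
    \<open>\<pi>\<close>.\<close>
  have 2: "(\<integral>\<^sup>+z. F (T1 z) \<partial>PiM (?WB \<union> ?S) L) = (\<integral>\<^sup>+z. F (T1 (T2 z)) \<partial>PiM (?WB \<union> ?M) L)"
    unfolding T2_def
  proof (rule nn_integral_triangular[where \<pi> = \<pi> and g = coin and f = "\<lambda>z. F (T1 z)"])
    fix z c assume "c \<in> ?S"
    then obtain a where c: "c = Sign a" by (auto simp: sign_coords_def)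
    have "(\<lambda>t::real. if t = 1 then sa z a else - sa z a) \<in> borel_measurable borel"
      by measurable
    from distr_two_point[OF this, of 1 0] show "distr (L (\<pi> c)) borel (coin z c) = L c"
      by (auto simp: c \<pi>_def coin_def[abs_def] sa_def two_point_commute)
    show "coin z c \<in> borel_measurable borel"
      by (simp add: c coin_def[abs_def])
  next
    fix z z' :: "coord \<Rightarrow> real" and c
    assume c: "c \<in> ?S" and eq: "\<And>d. d \<in> ?WB \<Longrightarrow> z d = z' d"
    have "act z = act z'"
      unfolding act_def using eq
      by (metis (mono_tags, lifting) weight_mat_cong bias_vec_cong weight_layer_def bias_layer_def
          UnI1 UnI2 mem_Collect_eq)
    then show "coin z c = coin z' c"
      by (simp add: fun_eq_iff coin_def sa_def split: coord.split)
  next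
    fix c assume "c \<in> ?S"
    then obtain a where c: "c = Sign a" "a < n i" by (auto simp: sign_coords_def)
    have [measurable]: "(\<lambda>z. sa z a) \<in> borel_measurable (PiM (?WB \<union> ?M) L)"
      unfolding sa_def act_index[OF c(2)] by measurable
    show "(\<lambda>z. coin z c (z (\<pi> c))) \<in> borel_measurable (PiM (?WB \<union> ?M) L)"
      unfolding coin_def c by simp
  next
    show "(\<lambda>z. F (T1 z)) \<in> borel_measurable (PiM (?WB \<union> ?S) L)"
      using T1 F by (rule measurable_compose)
  qed (simp_all, auto simp: sign_coords_def weight_layer_def bias_layer_def mask_layer_def \<pi>_def inj_on_def)
  \<comment> \<open>At a zero preactivation the gate is closed for either sign, so a mask equal to 1
    could not be matched.\<close>
  have "AE z in PiM (?WB \<union> ?M) L. \<forall>a\<in>{..<n i}. act z $ a \<noteq> 0"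
  proof (intro eventually_ball_finite ballI finite_lessThan)
    fix a assume "a \<in> {..<n i}"
    then have a: "a < n i" by simp
    show "AE z in PiM (?WB \<union> ?M) L. act z $ a \<noteq> 0"
      unfolding act_index[OF a]
      by (rule AE_add_coord_nonzero)
        (use a in \<open>auto simp: bias_layer_def admissible_singleton[OF \<nu>]\<close>)
  qed
  moreover have "AE z in PiM (?WB \<union> ?M) L. \<forall>a\<in>{..<n i}. z (Mask i a) = 1 \<or> z (Mask i a) = 0"
  proof (intro eventually_ball_finite ballI finite_lessThan)
    fix a assume "a \<in> {..<n i}"
    then have "Mask i a \<in> ?WB \<union> ?M" by (simp add: mask_layer_def)
    then show "AE z in PiM (?WB \<union> ?M) L. z (Mask i a) = 1 \<or> z (Mask i a) = 0"
      by (rule AE_PiM_component[OF prob_space_law]) (unfold law.simps, rule AE_two_point)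
  qed
  ultimately have "AE z in PiM (?WB \<union> ?M) L. F (T1 (T2 z)) = \<phi> (mask_mat n z i * weight_mat n z i * P)"
  proof eventually_elim
    case (elim z)
    define \<xi> where "\<xi> a = (if z (Mask i a) = 1 then sa z a else - sa z a)" for a
    have \<xi>: "\<xi> a = 1 \<or> \<xi> a = - 1" for a by (auto simp: \<xi>_def sa_def)
    have sg\<xi>: "sg (\<xi> a) = \<xi> a" for a using \<xi>[of a] by (auto simp: sg_def)
    define z' where "z' = T1 (T2 z)"
    have T2: "T2 z (Sign a) = \<xi> a" "T2 z (Bias i a) = z (Bias i a)" if "a < n i" for a
      using that
      by (auto simp: T2_def sign_coords_def bias_layer_def weight_layer_def coin_def \<pi>_def \<xi>_def)
    have T2w: "T2 z (Weight i a b) = z (Weight i a b)" if "a < n i" "b < n (i - 1)" for a b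
      using that by (auto simp: T2_def sign_coords_def bias_layer_def weight_layer_def)
    have z': "z' (Sign a) = \<xi> a" "z' (Bias i a) = \<xi> a * z (Bias i a)" if "a < n i" for a
      using that T2[OF that] sg\<xi>
      by (auto simp: z'_def T1_def flip_def sign_coords_def bias_layer_def weight_layer_def)
    have z'w: "z' (Weight i a b) = \<xi> a * z (Weight i a b)" if "a < n i" "b < n (i - 1)" for a b
      using that T2(1)[OF that(1)] T2w[OF that] sg\<xi>
      by (auto simp: z'_def T1_def flip_def sign_coords_def bias_layer_def weight_layer_def)
    have S: "sign_mat (n i) z' = mat_diag (n i) \<xi>"
      unfolding sign_mat_def by (intro mat_diag_cong z')
    have W: "weight_mat n z' i = mat_diag (n i) \<xi> * weight_mat n z i"
      by (subst mat_diag_mult_left[OF coord_matrices_carrier(1)]) (auto simp: weight_mat_def z'w)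
    have "act z' $ a = \<xi> a * act z $ a" if "a < n i" for a
      using that by (simp add: act_index z' z'w sum_distrib_left algebra_simps)
    then have "gate (act z') = mat_diag (n i) (\<lambda>a. of_bool (0 < \<xi> a * act z $ a))"
      using act_carrier[of z'] unfolding gate_def by (auto intro!: mat_diag_cong)
    \<comment> \<open>The flipped preactivation is positive exactly when \<open>\<xi> a\<close> is
      the sign of the original one, that is when the mask is 1; the outer factors multiply to
      1.\<close>
    moreover have "\<xi> a * of_bool (0 < \<xi> a * act z $ a) * \<xi> a = z (Mask i a)" if "a < n i" for a
    proof -
      from elim that have "act z $ a \<noteq> 0" "z (Mask i a) = 1 \<or> z (Mask i a) = 0" by auto
      then show ?thesis by (cases "0 < act z $ a") (auto simp: \<xi>_def sa_def)
    qed
    ultimately show ?case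
      using P by (simp add: F_def z'_def[symmetric] S W mat_diag_sandwich[OF coord_matrices_carrier(1)] mask_mat_def)
  qed
  then have "(\<integral>\<^sup>+z. F (T1 (T2 z)) \<partial>PiM (?WB \<union> ?M) L) =
      (\<integral>\<^sup>+z. \<phi> (mask_mat n z i * weight_mat n z i * P) \<partial>PiM (?WB \<union> ?M) L)"
    by (rule nn_integral_cong_AE)
  \<comment> \<open>With the gates replaced by masks the integrand no longer reads the biases, which
    are integrated out.\<close>
  also have "\<dots> = (\<integral>\<^sup>+z. \<phi> (mask_mat n z i * weight_mat n z i * P) \<partial>PiM (weight_layer n i \<union> ?M) L)"
  proof (rule nn_integral_marginal)
    show "(\<lambda>z. \<phi> (mask_mat n z i * weight_mat n z i * P)) \<in> borel_measurable (PiM (weight_layer n i \<union> ?M) L)"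
      by (rule measurable_compose[OF measurable_masked_layer[where n = n and i = i, OF P] \<phi>])
    fix z :: "coord \<Rightarrow> real"
    let ?z = "restrict z (weight_layer n i \<union> ?M)"
    have "mask_mat n ?z i = mask_mat n z i" "weight_mat n ?z i = weight_mat n z i"
      by (auto intro!: mask_mat_cong weight_mat_cong simp: mask_layer_def weight_layer_def)
    then show "\<phi> (mask_mat n ?z i * weight_mat n ?z i * P) = \<phi> (mask_mat n z i * weight_mat n z i * P)"
      by simp
  qed auto
  finally show ?thesis
    using 1 2 by (simp add: Un_commute[of ?S ?WB] F_def act_def)
qed

text \<open>By associativity the signs pass from the rows of \<open>P\<close> to the columns of the
  weight matrix, where multiplying column \<open>b\<close> by \<open>e b\<close> leaves the law
  unchanged.\<close>

lemma layer_step_sign_invariant: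
  fixes n :: "nat \<Rightarrow> nat" and i r :: nat
  assumes e: "\<And>b. e b = 1 \<or> e b = - 1" and P: "P \<in> carrier_mat (n (i - 1)) r"
    and \<phi>: "\<phi> \<in> borel_measurable (mat_borel (n i) r)"
  shows "(\<integral>\<^sup>+z. \<phi> (mask_mat n z i * weight_mat n z i * (mat_diag (n (i - 1)) e * P))
      \<partial>PiM (weight_layer n i \<union> mask_layer n i) L) =
    (\<integral>\<^sup>+z. \<phi> (mask_mat n z i * weight_mat n z i * P) \<partial>PiM (weight_layer n i \<union> mask_layer n i) L)"
    (is "?lhs = (\<integral>\<^sup>+z. ?f z \<partial>PiM ?I L)")
proof -
  define g where "g c t = (case c of Weight _ _ b \<Rightarrow> e b * t | _ \<Rightarrow> t)" for c t
  have f: "?f \<in> borel_measurable (PiM ?I L)"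
    by (rule measurable_compose[OF measurable_masked_layer[where n = n and i = i, OF P] \<phi>])
  have "?lhs = (\<integral>\<^sup>+z. ?f (\<lambda>c\<in>?I. g c (z c)) \<partial>PiM ?I L)"
  proof (intro nn_integral_cong arg_cong[where f = \<phi>])
    fix z
    let ?z = "\<lambda>c\<in>?I. g c (z c)"
    have mask: "mask_mat n ?z i = mask_mat n z i"
      by (rule mask_mat_cong) (simp add: g_def mask_layer_def)
    have weight: "weight_mat n ?z i = weight_mat n z i * mat_diag (n (i - 1)) e"
      by (subst mat_diag_mult_right[OF coord_matrices_carrier(1)])
        (auto simp: weight_mat_def g_def weight_layer_def)
    have "mask_mat n ?z i * weight_mat n ?z i = mask_mat n z i * weight_mat n z i * mat_diag (n (i - 1)) e"
      unfolding mask weight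
      by (rule assoc_mult_mat[symmetric, OF coord_matrices_carrier(3) coord_matrices_carrier(1) mat_diag_dim])
    moreover have "mask_mat n z i * weight_mat n z i \<in> carrier_mat (n i) (n (i - 1))"
      by (rule mult_carrier_mat[OF coord_matrices_carrier(3) coord_matrices_carrier(1)])
    from assoc_mult_mat[OF this mat_diag_dim P]
    have "mask_mat n z i * weight_mat n z i * (mat_diag (n (i - 1)) e * P) =
        mask_mat n z i * weight_mat n z i * mat_diag (n (i - 1)) e * P" ..
    ultimately show "mask_mat n z i * weight_mat n z i * (mat_diag (n (i - 1)) e * P) =
        mask_mat n ?z i * weight_mat n ?z i * P"
      by (simp only:)
  qed
  also have "\<dots> = (\<integral>\<^sup>+z. ?f z \<partial>PiM ?I L)"
  proof (rule nn_integral_coordinatewise[where \<pi> = "\<lambda>c. c"])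
    fix c assume "c \<in> ?I"
    then consider a b where "c = Weight i a b" | a where "c = Mask i a"
      by (auto simp: weight_layer_def mask_layer_def)
    then show "distr (L c) borel (g c) = L c"
    proof cases
      case 1
      then show ?thesis by (simp add: g_def[abs_def] admissible_scale[OF \<mu> e])
    next
      case 2
      then show ?thesis by (simp add: g_def[abs_def] distr_id2)
    qed
    show "g c \<in> borel_measurable borel"
      unfolding g_def[abs_def] by (cases c) simp_all
  qed (use f in auto)
  finally show ?thesis .
qed

end

text \<open>The almost sure value of the Jacobian as a function of the coordinates. Unlike
  \<open>Jac\<close> it satisfies a layer recursion at every point, so the induction runs on
  it.\<close>

definition relu_product ::
  "(nat \<Rightarrow> nat) \<Rightarrow> real Matrix.vec \<Rightarrow> nat \<Rightarrow> (coord \<Rightarrow> real) \<Rightarrow> nat \<Rightarrow> real Matrix.mat" where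
  "relu_product n x j z k =
    gated_product n (\<lambda>i. gate (preact (weight_mat n z) (bias_vec n z) x i)) (weight_mat n z) j k"

definition mask_product ::
  "(nat \<Rightarrow> nat) \<Rightarrow> nat \<Rightarrow> (coord \<Rightarrow> real) \<Rightarrow> nat \<Rightarrow> real Matrix.mat" where
  "mask_product n j z k = gated_product n (mask_mat n z) (weight_mat n z) j k"

lemma relu_product_Suc:
  assumes "j \<le> k"
  shows "relu_product n x j z (Suc k) =
    gate (weight_mat n z (Suc k) *\<^sub>v layer_map (weight_mat n z) (bias_vec n z) 0 k x + bias_vec n z (Suc k)) *
      weight_mat n z (Suc k) * relu_product n x j z k"
  using assms by (simp add: relu_product_def gated_product_Suc preact_def)

lemma mask_product_Suc:
  "j \<le> k \<Longrightarrow> mask_product n j z (Suc k) =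
    mask_mat n z (Suc k) * weight_mat n z (Suc k) * mask_product n j z k"
  by (simp add: mask_product_def gated_product_Suc)

lemma relu_product_carrier:
  "j \<le> k \<Longrightarrow> x \<in> carrier_vec (n 0) \<Longrightarrow> relu_product n x j z k \<in> carrier_mat (n k) (n j)"
  unfolding relu_product_def
  by (intro gated_product_carrier gate_carrier preact_carrier coord_matrices_carrier)

lemma weight_bias_cong:
  assumes "\<And>c. c \<in> weight_coords n k \<union> bias_coords n k \<Longrightarrow> z c = z' c" "0 < i" "i \<le> k"
  shows "weight_mat n z i = weight_mat n z' i" "bias_vec n z i = bias_vec n z' i"
proof -
  show "weight_mat n z i = weight_mat n z' i"
    by (rule weight_mat_cong, rule assms(1)) (use assms(2,3) in \<open>auto simp: weight_coords_def\<close>)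
  show "bias_vec n z i = bias_vec n z' i"
    by (rule bias_vec_cong, rule assms(1)) (use assms(2,3) in \<open>auto simp: bias_coords_def\<close>)
qed

text \<open>Layers up to \<open>k\<close> read only weights and biases up to \<open>k\<close>; this
  is what lets Fubini separate the next layer from them.\<close>

lemma relu_product_cong:
  assumes eq: "\<And>c. c \<in> weight_coords n k \<union> bias_coords n k \<Longrightarrow> z c = z' c"
  shows "layer_map (weight_mat n z) (bias_vec n z) 0 k x = layer_map (weight_mat n z') (bias_vec n z') 0 k x"
    and "relu_product n x j z k = relu_product n x j z' k"
proof -
  note wb = weight_bias_cong[of n k z z', OF eq]
  show "layer_map (weight_mat n z) (bias_vec n z) 0 k x = layer_map (weight_mat n z') (bias_vec n z') 0 k x"
    by (intro fun_cong[OF layer_map_cong] wb) auto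
  have "preact (weight_mat n z) (bias_vec n z) x i = preact (weight_mat n z') (bias_vec n z') x i"
    if "j < i" "i \<le> k" for i
  proof -
    have "layer_map (weight_mat n z) (bias_vec n z) 0 (i - 1) x =
        layer_map (weight_mat n z') (bias_vec n z') 0 (i - 1) x"
      by (intro fun_cong[OF layer_map_cong] wb) (use that in auto)
    then show ?thesis using wb[of i] that by (simp add: preact_def)
  qed
  then show "relu_product n x j z k = relu_product n x j z' k"
    unfolding relu_product_def by (intro gated_product_cong) (auto intro: wb(1))
qed

lemma mask_product_cong:
  assumes eq: "\<And>c. c \<in> weight_coords n k \<union> mask_coords n j k \<Longrightarrow> z c = z' c"
  shows "mask_product n j z k = mask_product n j z' k"
  unfolding mask_product_def
proof (rule gated_product_cong)
  fix i assume i: "j < i" "i \<le> k"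
  show "mask_mat n z i = mask_mat n z' i"
    by (rule mask_mat_cong, rule eq) (use i in \<open>auto simp: mask_coords_def\<close>)
  show "weight_mat n z i = weight_mat n z' i"
    by (rule weight_mat_cong, rule eq) (use i in \<open>auto simp: weight_coords_def\<close>)
qed

lemma weight_coords_Suc: "weight_coords n (Suc k) = weight_coords n k \<union> weight_layer n (Suc k)"
  and bias_coords_Suc: "bias_coords n (Suc k) = bias_coords n k \<union> bias_layer n (Suc k)"
  and mask_coords_Suc: "j \<le> k \<Longrightarrow> mask_coords n j (Suc k) = mask_coords n j k \<union> mask_layer n (Suc k)"
proof -
  show "weight_coords n (Suc k) = weight_coords n k \<union> weight_layer n (Suc k)"
    "bias_coords n (Suc k) = bias_coords n k \<union> bias_layer n (Suc k)"
    by (simp_all add: weight_coords_eq bias_coords_eq atLeastAtMostSuc_conv Un_commute)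
  assume "j \<le> k"
  then have "{j<..Suc k} = insert (Suc k) {j<..k}" by auto
  then show "mask_coords n j (Suc k) = mask_coords n j k \<union> mask_layer n (Suc k)"
    by (simp add: mask_coords_eq Un_commute)
qed

context net_laws
begin

lemma measurable_relu_product:
  "j \<le> k \<Longrightarrow> x \<in> carrier_vec (n 0) \<Longrightarrow>
    (\<lambda>z. relu_product n x j z k) \<in> measurable (PiM I L) (mat_borel (n k) (n j))"
  unfolding relu_product_def
  by (intro measurable_gated_product measurable_gate measurable_vec_preact
      measurable_coord_matrices measurable_bias_vec)

lemma measurable_mask_product:
  "j \<le> k \<Longrightarrow> (\<lambda>z. mask_product n j z k) \<in> measurable (PiM I L) (mat_borel (n k) (n j))"
  unfolding mask_product_def
  by (intro measurable_gated_product measurable_coord_matrices)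

text \<open>The induction hypothesis. No sign coordinates appear in it, since a test function
  invariant under row signs cannot see them; for arbitrary test functions the equation would fail in
  general.\<close>

definition sign_invariant_eq :: "(nat \<Rightarrow> nat) \<Rightarrow> real Matrix.vec \<Rightarrow> nat \<Rightarrow> nat \<Rightarrow> bool" where
  "sign_invariant_eq n x j k \<longleftrightarrow> (\<forall>\<psi>\<in>borel_measurable (mat_borel (n k) (n j)).
    (\<forall>e P. (\<forall>a. e a = 1 \<or> e a = - 1) \<longrightarrow> P \<in> carrier_mat (n k) (n j) \<longrightarrow>
      \<psi> (mat_diag (n k) e * P) = \<psi> P) \<longrightarrow>
    (\<integral>\<^sup>+z. \<psi> (relu_product n x j z k) \<partial>PiM (weight_coords n k \<union> bias_coords n k) L) =
    (\<integral>\<^sup>+z. \<psi> (mask_product n j z k) \<partial>PiM (weight_coords n k \<union> mask_coords n j k) L))"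

text \<open>With signs attached to the new layer, \<open>\<phi>\<close> may be arbitrary:
  integrating out that layer leaves a function of the old Jacobian which is invariant under row
  signs, so the weaker hypothesis on the old layers is enough.\<close>

lemma relu_product_step:
  assumes "j \<le> k" and x: "x \<in> carrier_vec (n 0)" and IH: "sign_invariant_eq n x j k"
    and \<phi>: "\<phi> \<in> borel_measurable (mat_borel (n (Suc k)) (n j))"
  shows "(\<integral>\<^sup>+z. \<phi> (sign_mat (n (Suc k)) z * relu_product n x j z (Suc k))
      \<partial>PiM (weight_coords n (Suc k) \<union> bias_coords n (Suc k) \<union> sign_coords (n (Suc k))) L) =
    (\<integral>\<^sup>+z. \<phi> (mask_product n j z (Suc k)) \<partial>PiM (weight_coords n (Suc k) \<union> mask_coords n j (Suc k)) L)"
proof -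
  \<comment> \<open>The layer lemmas write the input width as \<open>n (i - 1)\<close>;
    \<open>k\<close> is rewritten to that form.\<close>
  define i where "i = Suc k"
  have k: "k = i - 1" "j \<le> i" using \<open>j \<le> k\<close> by (simp_all add: i_def)
  let ?A = "weight_coords n k \<union> bias_coords n k" and ?R = "weight_coords n k \<union> mask_coords n j k"
  let ?N1 = "weight_layer n i \<union> bias_layer n i \<union> sign_coords (n i)"
    and ?N2 = "weight_layer n i \<union> mask_layer n i"
  have A: "weight_coords n i \<union> bias_coords n i \<union> sign_coords (n i) = ?A \<union> ?N1"
    unfolding i_def weight_coords_Suc bias_coords_Suc by blast
  have R: "weight_coords n i \<union> mask_coords n j i = ?R \<union> ?N2"
    unfolding i_def weight_coords_Suc mask_coords_Suc[OF \<open>j \<le> k\<close>] by blast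
  have disjoint: "?A \<inter> ?N1 = {}" "?R \<inter> ?N2 = {}"
    by (auto simp: weight_coords_def bias_coords_def mask_coords_def weight_layer_def bias_layer_def
        mask_layer_def sign_coords_def i_def)
  define \<psi> where "\<psi> P = (\<integral>\<^sup>+w. \<phi> (mask_mat n w i * weight_mat n w i * P) \<partial>PiM ?N2 L)" for P
  have \<phi>i: "\<phi> \<in> borel_measurable (mat_borel (n i) (n j))"
    using \<phi> by (simp add: i_def)
  interpret N2: prob_space "PiM ?N2 L" by (rule prob_space_PiM_law)
  have fst: "fst \<in> measurable (mat_borel (n k) (n j) \<Otimes>\<^sub>M PiM ?N2 L) (mat_borel (n (i - 1)) (n j))"
    unfolding k(1)[symmetric] by (rule measurable_fst)
  have "(\<lambda>(P, w). \<phi> (mask_mat n w i * weight_mat n w i * P))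
      \<in> borel_measurable (mat_borel (n k) (n j) \<Otimes>\<^sub>M PiM ?N2 L)"
    unfolding split_beta
    by (rule measurable_compose[OF measurable_mult_mat[OF measurable_mult_mat[OF
          measurable_compose[OF measurable_snd measurable_coord_matrices(2)[where n = n and i = i]]
          measurable_compose[OF measurable_snd measurable_coord_matrices(1)[where n = n and i = i]]]
          fst] \<phi>i])
  then have \<psi>: "\<psi> \<in> borel_measurable (mat_borel (n k) (n j))"
    unfolding \<psi>_def[abs_def] by (rule N2.borel_measurable_nn_integral)
  have \<psi>_inv: "\<psi> (mat_diag (n k) e * P) = \<psi> P"
    if "\<And>a. e a = 1 \<or> e a = - 1" "P \<in> carrier_mat (n k) (n j)" for e P
    unfolding \<psi>_def k
    by (rule layer_step_sign_invariant) (use that \<phi>i in \<open>simp_all add: k\<close>)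
  let ?F = "\<lambda>z. \<phi> (sign_mat (n i) z * relu_product n x j z i)"
  have F: "?F \<in> borel_measurable (PiM (?A \<union> ?N1) L)"
    by (rule measurable_compose[OF measurable_mult_mat[OF measurable_coord_matrices(3)
          measurable_relu_product[where n = n and k = i, OF k(2) x]] \<phi>i])
  have "(\<integral>\<^sup>+z. ?F z \<partial>PiM (?A \<union> ?N1) L) = (\<integral>\<^sup>+u. \<integral>\<^sup>+w. ?F (merge ?A ?N1 (u, w)) \<partial>PiM ?N1 L \<partial>PiM ?A L)"
    by (rule product_nn_integral_fold) (use disjoint F in simp_all)
  \<comment> \<open>The old coordinates \<open>u\<close> enter the new layer through its input and
    through the old Jacobian; by \<open>layer_step\<close> only the latter survives the inner
    integral.\<close>
  also have "\<dots> = (\<integral>\<^sup>+u. \<psi> (relu_product n x j u k) \<partial>PiM ?A L)"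
  proof (rule nn_integral_cong)
    fix u :: "coord \<Rightarrow> real"
    let ?v = "layer_map (weight_mat n u) (bias_vec n u) 0 k x"
    have v: "?v \<in> carrier_vec (n (i - 1))"
      unfolding k(1)[symmetric] by (rule layer_map_carrier, rule coord_matrices_carrier, rule coord_matrices_carrier)
        (simp_all add: x)
    have P: "relu_product n x j u k \<in> carrier_mat (n (i - 1)) (n j)"
      unfolding k(1)[symmetric] by (rule relu_product_carrier[where n = n, OF \<open>j \<le> k\<close> x])
    have "?F (merge ?A ?N1 (u, w)) = \<phi> (sign_mat (n i) w *
        (gate (weight_mat n w i *\<^sub>v ?v + bias_vec n w i) * weight_mat n w i * relu_product n x j u k))" for w
    proof -
      let ?z = "merge ?A ?N1 (u, w)"
      have z: "?z c = w c" if "c \<in> ?N1" for c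
        using that disjoint(1) by (auto simp: merge_def)
      have old: "layer_map (weight_mat n ?z) (bias_vec n ?z) 0 k x = ?v"
        "relu_product n x j ?z k = relu_product n x j u k"
        by (rule relu_product_cong; simp add: merge_def)+
      have new: "weight_mat n ?z i = weight_mat n w i" "bias_vec n ?z i = bias_vec n w i"
        "sign_mat (n i) ?z = sign_mat (n i) w"
        by (rule weight_mat_cong bias_vec_cong sign_mat_cong, rule z,
            simp add: weight_layer_def bias_layer_def sign_coords_def)+
      have "relu_product n x j ?z i = gate (weight_mat n ?z i *\<^sub>v
          layer_map (weight_mat n ?z) (bias_vec n ?z) 0 k x + bias_vec n ?z i) *
          weight_mat n ?z i * relu_product n x j ?z k"
        unfolding i_def by (rule relu_product_Suc[OF \<open>j \<le> k\<close>])
      then show ?thesis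
        unfolding old new by simp
    qed
    then show "(\<integral>\<^sup>+w. ?F (merge ?A ?N1 (u, w)) \<partial>PiM ?N1 L) = \<psi> (relu_product n x j u k)"
      unfolding \<psi>_def using layer_step[OF v P \<phi>i] by simp
  qed
  also have "\<dots> = (\<integral>\<^sup>+u. \<psi> (mask_product n j u k) \<partial>PiM ?R L)"
    using IH \<psi> \<psi>_inv unfolding sign_invariant_eq_def by blast
  also have "\<dots> = (\<integral>\<^sup>+u. \<integral>\<^sup>+w. \<phi> (mask_product n j (merge ?R ?N2 (u, w)) i) \<partial>PiM ?N2 L \<partial>PiM ?R L)"
    unfolding \<psi>_def
  proof (intro nn_integral_cong arg_cong[where f = \<phi>])
    fix u w :: "coord \<Rightarrow> real"
    let ?z = "merge ?R ?N2 (u, w)"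
    have z: "?z c = w c" if "c \<in> ?N2" for c
      using that disjoint(2) by (auto simp: merge_def)
    have old: "mask_product n j ?z k = mask_product n j u k"
      by (rule mask_product_cong; simp add: merge_def)
    have new: "weight_mat n ?z i = weight_mat n w i" "mask_mat n ?z i = mask_mat n w i"
      by (rule weight_mat_cong mask_mat_cong, rule z, simp add: weight_layer_def mask_layer_def)+
    have "mask_product n j ?z i = mask_mat n ?z i * weight_mat n ?z i * mask_product n j ?z k"
      unfolding i_def by (rule mask_product_Suc[OF \<open>j \<le> k\<close>])
    then show "mask_mat n w i * weight_mat n w i * mask_product n j u k = mask_product n j ?z i"
      unfolding old new by simp
  qed
  also have "\<dots> = (\<integral>\<^sup>+z. \<phi> (mask_product n j z i) \<partial>PiM (?R \<union> ?N2) L)"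
    by (rule product_nn_integral_fold[symmetric])
      (use disjoint measurable_compose[OF measurable_mask_product[where n = n and k = i, OF k(2)] \<phi>i] in simp_all)
  finally show ?thesis
    by (simp only: A[unfolded i_def] R[unfolded i_def] i_def)
qed

text \<open>Fresh signs are adjoined as unread coordinates and then multiplied in, which
  \<open>\<psi>\<close> does not notice; the signed statement for this layer then applies.\<close>

lemma sign_invariant_eq_Suc:
  assumes "j \<le> k" and x: "x \<in> carrier_vec (n 0)" and IH: "sign_invariant_eq n x j k"
  shows "sign_invariant_eq n x j (Suc k)"
  unfolding sign_invariant_eq_def
proof (intro ballI impI)
  let ?i = "Suc k"
  let ?A = "weight_coords n ?i \<union> bias_coords n ?i" and ?S = "sign_coords (n ?i)"
  have "j \<le> ?i" using \<open>j \<le> k\<close> by simp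
  fix \<psi> :: "real Matrix.mat \<Rightarrow> ennreal"
  assume \<psi>: "\<psi> \<in> borel_measurable (mat_borel (n ?i) (n j))"
    and inv: "\<forall>e P. (\<forall>a. e a = 1 \<or> e a = - 1) \<longrightarrow> P \<in> carrier_mat (n ?i) (n j) \<longrightarrow>
      \<psi> (mat_diag (n ?i) e * P) = \<psi> P"
  have "(\<integral>\<^sup>+z. \<psi> (relu_product n x j z ?i) \<partial>PiM ?A L) =
      (\<integral>\<^sup>+z. \<psi> (relu_product n x j z ?i) \<partial>PiM (?A \<union> ?S) L)"
  proof (rule nn_integral_marginal[symmetric])
    show "(\<lambda>z. \<psi> (relu_product n x j z ?i)) \<in> borel_measurable (PiM ?A L)"
      by (rule measurable_compose[OF measurable_relu_product[where n = n, OF \<open>j \<le> ?i\<close> x] \<psi>])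
    show "\<psi> (relu_product n x j (restrict z ?A) ?i) = \<psi> (relu_product n x j z ?i)" for z
      by (intro arg_cong[where f = \<psi>] relu_product_cong(2)) simp
  qed auto
  also have "\<dots> = (\<integral>\<^sup>+z. \<psi> (sign_mat (n ?i) z * relu_product n x j z ?i) \<partial>PiM (?A \<union> ?S) L)"
  proof (rule nn_integral_cong_AE)
    have "AE z in PiM (?A \<union> ?S) L. \<forall>a\<in>{..<n ?i}. z (Sign a) = 1 \<or> z (Sign a) = - 1"
    proof (intro eventually_ball_finite ballI finite_lessThan)
      fix a assume "a \<in> {..<n ?i}"
      then have "Sign a \<in> ?A \<union> ?S" by (simp add: sign_coords_def)
      then show "AE z in PiM (?A \<union> ?S) L. z (Sign a) = 1 \<or> z (Sign a) = - 1"
        by (rule AE_PiM_component[OF prob_space_law]) (unfold law.simps, rule AE_two_point)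
    qed
    then show "AE z in PiM (?A \<union> ?S) L. \<psi> (relu_product n x j z ?i) =
        \<psi> (sign_mat (n ?i) z * relu_product n x j z ?i)"
    proof eventually_elim
      case (elim z)
      \<comment> \<open>Invariance is available only for functions equal to 1 or - 1 at every index,
        whereas the sign coordinates are so only almost surely and below the width.\<close>
      define e where "e a = (if z (Sign a) = 1 then 1 else - 1 :: real)" for a
      have "sign_mat (n ?i) z = mat_diag (n ?i) e"
        unfolding sign_mat_def using elim by (intro mat_diag_cong) (auto simp: e_def)
      moreover have "\<forall>a. e a = 1 \<or> e a = - 1" by (simp add: e_def)
      ultimately show ?case
        using inv relu_product_carrier[where n = n, OF \<open>j \<le> ?i\<close> x] by metis
    qed
  qed
  also have "\<dots> = (\<integral>\<^sup>+z. \<psi> (mask_product n j z ?i) \<partial>PiM (weight_coords n ?i \<union> mask_coords n j ?i) L)"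
    by (rule relu_product_step[OF assms \<psi>])
  finally show "(\<integral>\<^sup>+z. \<psi> (relu_product n x j z ?i) \<partial>PiM ?A L) =
      (\<integral>\<^sup>+z. \<psi> (mask_product n j z ?i) \<partial>PiM (weight_coords n ?i \<union> mask_coords n j ?i) L)" .
qed

lemma sign_invariant_eq:
  assumes "j \<le> k" and x: "x \<in> carrier_vec (n 0)"
  shows "sign_invariant_eq n x j k"
  using \<open>j \<le> k\<close>
proof (induction k rule: dec_induct)
  \<comment> \<open>Both products are the identity matrix, so both integrals are of the same
    constant against probability measures.\<close>
  case base
  show ?case
    by (simp add: sign_invariant_eq_def relu_product_def mask_product_def
        prob_space.emeasure_space_1[OF prob_space_PiM_law])
next
  case (step k)
  then show ?case by (intro sign_invariant_eq_Suc x)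
qed

text \<open>The strict inequality \<open>j < k\<close> provides a last layer carrying the signs,
  where arbitrary test functions are allowed; all earlier layers need only the sign-invariant
  statement.\<close>

lemma nn_integral_Jac:
  assumes "j < k" and x: "x \<in> carrier_vec (n 0)"
    and \<phi>: "\<phi> \<in> borel_measurable (mat_borel (n k) (n j))"
  shows "(\<integral>\<^sup>+z. \<phi> (sign_mat (n k) z * Jac n (weight_mat n z) (bias_vec n z) x j k)
      \<partial>PiM (weight_coords n k \<union> bias_coords n k \<union> sign_coords (n k)) L) =
    (\<integral>\<^sup>+z. \<phi> (mask_product n j z k) \<partial>PiM (weight_coords n k \<union> mask_coords n j k) L)"
    (is "(\<integral>\<^sup>+z. _ z \<partial>PiM ?I L) = _")
proof -
  have "AE z in PiM ?I L. \<forall>i\<in>{j<..k}. \<forall>a\<in>{..<n i}. preact (weight_mat n z) (bias_vec n z) x i $ a \<noteq> 0"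
  proof (intro eventually_ball_finite ballI finite_lessThan finite_greaterThanAtMost)
    fix i a assume "i \<in> {j<..k}" "a \<in> {..<n i}"
    then have i: "0 < i" "i \<le> k" and a: "a < n i" by auto
    define v where "v z = layer_map (weight_mat n z) (bias_vec n z) 0 (i - 1) x" for z
    have v: "v z \<in> carrier_vec (n (i - 1))" for z
      unfolding v_def by (rule layer_map_carrier, rule coord_matrices_carrier, rule coord_matrices_carrier)
        (simp_all add: x)
    have vm: "measurable_vec (PiM ?I L) (n (i - 1)) v"
      unfolding v_def[abs_def]
      by (rule measurable_vec_layer_map)
        (simp_all add: measurable_coord_matrices(1)[simplified] measurable_bias_vec measurable_vec_const x)
    have [measurable]: "(\<lambda>z. v z $ c) \<in> borel_measurable (PiM ?I L)" if "c < n (i - 1)" for c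
      using vm that by (simp add: measurable_vec_def)
    have "AE z in PiM ?I L. (\<Sum>c<n (i - 1). z (Weight i a c) * v z $ c) + z (Bias i a) \<noteq> 0"
    proof (rule AE_add_coord_nonzero)
      show "Bias i a \<in> ?I" using i a by (simp add: bias_coords_def)
      show "(\<Sum>c<n (i - 1). (z(Bias i a := t)) (Weight i a c) * v (z(Bias i a := t)) $ c) =
          (\<Sum>c<n (i - 1). z (Weight i a c) * v z $ c)" for z t
      proof -
        \<comment> \<open>The input of layer \<open>i\<close> reads only coordinates of layers up to
          \<open>i - 1\<close>, so the bias of layer \<open>i\<close> is free to vary.\<close>
        have "v (z(Bias i a := t)) = v z"
          unfolding v_def
          by (rule relu_product_cong(1)) (auto simp: weight_coords_def bias_coords_def)
        then show ?thesis by simp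
      qed
      show "(\<lambda>z. \<Sum>c<n (i - 1). z (Weight i a c) * v z $ c) \<in> borel_measurable (PiM ?I L)"
        by (intro borel_measurable_sum borel_measurable_times) simp_all
    qed (simp_all add: admissible_singleton[OF \<nu>])
    moreover have "preact (weight_mat n z) (bias_vec n z) x i $ a =
        (\<Sum>c<n (i - 1). z (Weight i a c) * v z $ c) + z (Bias i a)" for z
      unfolding preact_def v_def[symmetric] using a v[of z]
      by (simp add: index_mult_mat_vec_sum[of _ "n i" "n (i - 1)"] bias_vec_def weight_mat_def
          del: index_mult_mat_vec)
    ultimately show "AE z in PiM ?I L. preact (weight_mat n z) (bias_vec n z) x i $ a \<noteq> 0"
      by simp
  qed
  then have "(\<integral>\<^sup>+z. \<phi> (sign_mat (n k) z * Jac n (weight_mat n z) (bias_vec n z) x j k) \<partial>PiM ?I L) =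
      (\<integral>\<^sup>+z. \<phi> (sign_mat (n k) z * relu_product n x j z k) \<partial>PiM ?I L)"
    unfolding relu_product_def
  proof (intro nn_integral_cong_AE, eventually_elim)
    case (elim z)
    have "Jac n (weight_mat n z) (bias_vec n z) x j k =
        gated_product n (\<lambda>i. gate (preact (weight_mat n z) (bias_vec n z) x i)) (weight_mat n z) j k"
      by (rule Jac_eq_gated_product, rule coord_matrices_carrier, rule coord_matrices_carrier)
        (use elim \<open>j < k\<close> x in auto)
    then show ?case by simp
  qed
  also obtain k' where k': "k = Suc k'" "j \<le> k'"
    using \<open>j < k\<close> by (cases k) auto
  have "(\<integral>\<^sup>+z. \<phi> (sign_mat (n k) z * relu_product n x j z k) \<partial>PiM ?I L) =
      (\<integral>\<^sup>+z. \<phi> (mask_product n j z k) \<partial>PiM (weight_coords n k \<union> mask_coords n j k) L)"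
    unfolding k'(1)
    by (rule relu_product_step[OF k'(2) x sign_invariant_eq[where n = n and k = k', OF k'(2) x]])
      (use \<phi> k'(1) in simp)
  finally show ?thesis .
qed

end

section \<open>Transfer from the given probability space to the product laws\<close>

lemma distr_two_atoms:
  fixes X :: "'w \<Rightarrow> real"
  assumes "prob_space M" "X \<in> borel_measurable M" "u \<noteq> w"
    and "measure M {\<omega> \<in> space M. X \<omega> = u} = 1 / 2" "measure M {\<omega> \<in> space M. X \<omega> = w} = 1 / 2"
  shows "distr M borel X = two_point u w"
proof -
  have "X -` {y} \<inter> space M = {\<omega> \<in> space M. X \<omega> = y}" for y by auto
  with assms show ?thesis
    by (intro eq_two_point prob_space.prob_space_distr) (simp_all add: measure_distr)
qed

text \<open>Independence says that the joint law is the product of the marginals;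
  \<open>I \<noteq> {}\<close> is the side condition of that characterisation.\<close>

lemma (in net_laws) distr_coords:
  assumes "prob_space M" "prob_space.indep_vars M (\<lambda>_. borel) X I" "I \<noteq> {}"
    and distr: "\<And>c. c \<in> I \<Longrightarrow> distr M borel (X c) = L c"
  shows "distr M (PiM I L) (\<lambda>\<omega>. \<lambda>c\<in>I. X c \<omega>) = PiM I L"
    and "(\<lambda>\<omega>. \<lambda>c\<in>I. X c \<omega>) \<in> measurable M (PiM I L)"
proof -
  interpret S: prob_space M by fact
  have X: "X c \<in> borel_measurable M" if "c \<in> I" for c
    using assms(2) that by (auto simp: S.indep_vars_def)
  then show "(\<lambda>\<omega>. \<lambda>c\<in>I. X c \<omega>) \<in> measurable M (PiM I L)"
    by (intro measurable_restrict) (simp add: measurable_law)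
  have "distr M (PiM I L) (\<lambda>\<omega>. \<lambda>c\<in>I. X c \<omega>) = distr M (PiM I (\<lambda>_. borel)) (\<lambda>\<omega>. \<lambda>c\<in>I. X c \<omega>)"
    by (intro distr_cong sets_PiM_cong refl sets_law)
  also have "\<dots> = PiM I (\<lambda>c. distr M borel (X c))"
    using S.indep_vars_iff_distr_eq_PiM'[OF assms(3) X] assms(2) by simp
  also have "\<dots> = PiM I L"
    by (rule PiM_cong) (simp_all add: distr)
  finally show "distr M (PiM I L) (\<lambda>\<omega>. \<lambda>c\<in>I. X c \<omega>) = PiM I L" .
qed

theorem proposition2:
  fixes M :: "'w measure"
    and \<mu> \<nu> :: "real measure"
    and d j j' :: nat
    and n :: "nat \<Rightarrow> nat"
    and x :: "real Matrix.vec"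
    and W D :: "nat \<Rightarrow> 'w \<Rightarrow> real Matrix.mat"
    and B :: "nat \<Rightarrow> 'w \<Rightarrow> real Matrix.vec"
    and \<eta> :: "'w \<Rightarrow> real Matrix.vec"
  assumes "prob_space M"
    and "admissible \<mu>" and "admissible \<nu>"
    and "\<And>i. i \<le> d \<Longrightarrow> 0 < n i"
    and "j < j'" and "j' \<le> d"
    and "x \<in> carrier_vec (n 0)"
    and "\<And>i \<omega>. i \<in> {1..d} \<Longrightarrow> \<omega> \<in> space M \<Longrightarrow> W i \<omega> \<in> carrier_mat (n i) (n (i - 1))"
    and "\<And>i \<omega>. i \<in> {1..d} \<Longrightarrow> \<omega> \<in> space M \<Longrightarrow> B i \<omega> \<in> carrier_vec (n i)"
    and "\<And>\<omega>. \<omega> \<in> space M \<Longrightarrow> \<eta> \<omega> \<in> carrier_vec (n j')"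
    and "\<And>i \<omega>. i \<in> {j<..j'} \<Longrightarrow> \<omega> \<in> space M \<Longrightarrow>
           D i \<omega> \<in> carrier_mat (n i) (n i) \<and> diagonal_mat (D i \<omega>)"
    and "prob_space.indep_vars M (\<lambda>_. borel) (coord_rv W B \<eta> D)
           (weight_coords n d \<union> bias_coords n d \<union> sign_coords (n j'))"
    and "prob_space.indep_vars M (\<lambda>_. borel) (coord_rv W B \<eta> D)
           (weight_coords n d \<union> mask_coords n j j')"
    and "\<And>i a b. i \<in> {1..d} \<Longrightarrow> a < n i \<Longrightarrow> b < n (i - 1) \<Longrightarrow>
           distr M borel (\<lambda>\<omega>. W i \<omega> $$ (a, b)) = \<mu>"
    and "\<And>i a. i \<in> {1..d} \<Longrightarrow> a < n i \<Longrightarrow> distr M borel (\<lambda>\<omega>. B i \<omega> $ a) = \<nu>"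
    and "\<And>a. a < n j' \<Longrightarrow> measure M {\<omega> \<in> space M. \<eta> \<omega> $ a = 1} = 1 / 2"
    and "\<And>a. a < n j' \<Longrightarrow> measure M {\<omega> \<in> space M. \<eta> \<omega> $ a = - 1} = 1 / 2"
    and "\<And>i a. i \<in> {j<..j'} \<Longrightarrow> a < n i \<Longrightarrow> measure M {\<omega> \<in> space M. D i \<omega> $$ (a, a) = 1} = 1 / 2"
    and "\<And>i a. i \<in> {j<..j'} \<Longrightarrow> a < n i \<Longrightarrow> measure M {\<omega> \<in> space M. D i \<omega> $$ (a, a) = 0} = 1 / 2"
  shows "distr M (mat_borel (n j') (n j))
           (\<lambda>\<omega>. Diag (\<eta> \<omega>) * Jac n (\<lambda>i. W i \<omega>) (\<lambda>i. B i \<omega>) x j j')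
       = distr M (mat_borel (n j') (n j))
           (\<lambda>\<omega>. gated_product n (\<lambda>i. D i \<omega>) (\<lambda>i. W i \<omega>) j j')"
proof -
  note M = assms(1) and \<mu>\<nu> = assms(2,3) and n_pos = assms(4) and j = assms(5,6) and x = assms(7)
    and W = assms(8) and B = assms(9) and \<eta> = assms(10) and D = assms(11)
    and indep = assms(12,13) and W_law = assms(14) and B_law = assms(15)
    and \<eta>_law = assms(16,17) and D_law = assms(18,19)
  interpret net_laws \<mu> \<nu> by unfold_locales (rule \<mu>\<nu>)+
  define X where "X = coord_rv W B \<eta> D"
  \<comment> \<open>Layers beyond \<open>j'\<close> are left out. The left-hand side reads weights,
    biases and signs, the right-hand side weights and masks; independence is given for each of the
    two families separately.\<close>
  let ?I = "weight_coords n j' \<union> bias_coords n j' \<union> sign_coords (n j')"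
  let ?K = "weight_coords n j' \<union> mask_coords n j j'"
  let ?mb = "mat_borel (n j') (n j)"
  \<comment> \<open>Positive widths make both index sets nonempty, as \<open>distr_coords\<close>
    requires.\<close>
  have "Weight j' 0 0 \<in> weight_coords n j'"
    using n_pos[of j'] n_pos[of "j' - 1"] j by (auto simp: weight_coords_def)
  then have nonempty: "?I \<noteq> {}" "?K \<noteq> {}" by auto
  have indep_I: "prob_space.indep_vars M (\<lambda>_. borel) X ?I"
    unfolding X_def by (rule prob_space.indep_vars_subset[OF M indep(1)])
      (use j in \<open>auto simp: weight_coords_def bias_coords_def\<close>)
  have indep_K: "prob_space.indep_vars M (\<lambda>_. borel) X ?K"
    unfolding X_def by (rule prob_space.indep_vars_subset[OF M indep(2)])
      (use j in \<open>auto simp: weight_coords_def\<close>)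
  have X_measurable: "X c \<in> borel_measurable M" if "c \<in> ?I \<union> ?K" for c
    using that indep_I indep_K by (auto simp: prob_space.indep_vars_def[OF M])
  have X_law: "distr M borel (X c) = L c" if "c \<in> ?I \<union> ?K" for c
  proof (cases c)
    case (Weight i a b)
    then show ?thesis
      using that j W_law[of i a b]
      by (auto simp: X_def weight_coords_def bias_coords_def sign_coords_def mask_coords_def)
  next
    case (Bias i a)
    then show ?thesis
      using that j B_law[of i a]
      by (auto simp: X_def weight_coords_def bias_coords_def sign_coords_def mask_coords_def)
  next
    case (Sign a)
    then have "a < n j'"
      using that by (auto simp: weight_coords_def bias_coords_def sign_coords_def mask_coords_def)
    then show ?thesis
      using X_measurable[OF that] \<eta>_law[of a]
      by (auto simp: Sign X_def intro!: distr_two_atoms[OF M])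
  next
    case (Mask i a)
    then have "i \<in> {j<..j'}" "a < n i"
      using that by (auto simp: weight_coords_def bias_coords_def sign_coords_def mask_coords_def)
    then show ?thesis
      using X_measurable[OF that] D_law[of i a]
      by (auto simp: Mask X_def intro!: distr_two_atoms[OF M])
  qed
  \<comment> \<open>Each side is a measurable function \<open>H\<close> of its coordinate family, so
    its law is the image under \<open>H\<close> of a product measure that no longer refers to
    \<open>M\<close>.\<close>
  have pushforward: "distr M ?mb F = distr (PiM J L) ?mb H"
    if J: "prob_space.indep_vars M (\<lambda>_. borel) X J" "J \<noteq> {}" "J \<subseteq> ?I \<union> ?K"
      and H: "H \<in> measurable (PiM J L) ?mb"
      and F: "\<And>\<omega>. \<omega> \<in> space M \<Longrightarrow> F \<omega> = H (\<lambda>c\<in>J. X c \<omega>)" for F H J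
  proof -
    note coords = distr_coords[OF M J(1,2) X_law]
    have "distr M ?mb F = distr M ?mb (H \<circ> (\<lambda>\<omega>. \<lambda>c\<in>J. X c \<omega>))"
      by (rule distr_cong) (simp_all add: F)
    also have "\<dots> = distr (distr M (PiM J L) (\<lambda>\<omega>. \<lambda>c\<in>J. X c \<omega>)) ?mb H"
      by (rule distr_distr[symmetric, OF H coords(2)]) (use J(3) in auto)
    also have "distr M (PiM J L) (\<lambda>\<omega>. \<lambda>c\<in>J. X c \<omega>) = PiM J L"
      by (rule coords(1)) (use J(3) in auto)
    finally show ?thesis .
  qed
  have weights: "W i \<omega> = weight_mat n (\<lambda>c\<in>J. X c \<omega>) i"
    if "weight_coords n j' \<subseteq> J" "0 < i" "i \<le> j'" "\<omega> \<in> space M" for J i \<omega>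
  proof -
    have "Weight i a b \<in> J" if "a < n i" "b < n (i - 1)" for a b
      using \<open>weight_coords n j' \<subseteq> J\<close> \<open>0 < i\<close> \<open>i \<le> j'\<close> that by (auto simp: weight_coords_def)
    then show ?thesis
      using W[of i \<omega>] that j by (intro eq_matI) (auto simp: weight_mat_def X_def)
  qed
  have biases: "B i \<omega> = bias_vec n (\<lambda>c\<in>?I. X c \<omega>) i" if "0 < i" "i \<le> j'" "\<omega> \<in> space M" for i \<omega>
    using B[of i \<omega>] that j by (intro eq_vecI) (auto simp: bias_vec_def X_def bias_coords_def)
  have masks: "D i \<omega> = mask_mat n (\<lambda>c\<in>?K. X c \<omega>) i" if "j < i" "i \<le> j'" "\<omega> \<in> space M" for i \<omega>
    using D[of i \<omega>] that
    by (intro eq_matI) (auto simp: mask_mat_def mat_diag_def X_def mask_coords_def diagonal_mat_def)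
  let ?H = "\<lambda>z. sign_mat (n j') z * Jac n (weight_mat n z) (bias_vec n z) x j j'"
  have H: "?H \<in> measurable (PiM J L) ?mb" for J
    by (intro measurable_mult_mat[OF measurable_coord_matrices(3)] measurable_Jac
        measurable_coord_matrices measurable_bias_vec x) (use j in simp)
  have K: "(\<lambda>z. mask_product n j z j') \<in> measurable (PiM J L) ?mb" for J
    using j by (intro measurable_mask_product) simp
  have "distr M ?mb (\<lambda>\<omega>. Diag (\<eta> \<omega>) * Jac n (\<lambda>i. W i \<omega>) (\<lambda>i. B i \<omega>) x j j') = distr (PiM ?I L) ?mb ?H"
  proof (rule pushforward[OF indep_I nonempty(1) _ H])
    fix \<omega> assume \<omega>: "\<omega> \<in> space M"
    let ?z = "\<lambda>c\<in>?I. X c \<omega>"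
    have "Diag (\<eta> \<omega>) = sign_mat (n j') ?z"
      using \<eta>[OF \<omega>] unfolding Diag_def sign_mat_def
      by (auto intro!: mat_diag_cong simp: X_def sign_coords_def)
    moreover have "layer_map (\<lambda>i. W i \<omega>) (\<lambda>i. B i \<omega>) k l = layer_map (weight_mat n ?z) (bias_vec n ?z) k l"
      if "l \<le> j'" for k l
      using that by (intro layer_map_cong weights biases \<omega>) auto
    ultimately show "Diag (\<eta> \<omega>) * Jac n (\<lambda>i. W i \<omega>) (\<lambda>i. B i \<omega>) x j j' = ?H ?z"
      using j by (simp add: Jac_def)
  qed auto
  also have "\<dots> = distr (PiM ?K L) ?mb (\<lambda>z. mask_product n j z j')"
  \<comment> \<open>Indicators of measurable sets of matrices are the test functions that recover
    equality of laws from equality of integrals.\<close>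
  proof (rule measure_eqI)
    fix A assume "A \<in> sets (distr (PiM ?I L) ?mb ?H)"
    then have A: "A \<in> sets ?mb" by simp
    have "emeasure (distr (PiM ?I L) ?mb ?H) A = (\<integral>\<^sup>+z. indicator A (?H z) \<partial>PiM ?I L)"
      using A H by (subst nn_integral_distr[symmetric, where f = "indicator A" and M' = ?mb]) simp_all
    also have "\<dots> = (\<integral>\<^sup>+z. indicator A (mask_product n j z j') \<partial>PiM ?K L)"
      using A by (intro nn_integral_Jac j x) simp
    also have "\<dots> = emeasure (distr (PiM ?K L) ?mb (\<lambda>z. mask_product n j z j')) A"
      using A K by (subst nn_integral_distr[symmetric, where f = "indicator A" and M' = ?mb]) simp_all
    finally show "emeasure (distr (PiM ?I L) ?mb ?H) A =
        emeasure (distr (PiM ?K L) ?mb (\<lambda>z. mask_product n j z j')) A" .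
  qed simp
  also have "\<dots> = distr M ?mb (\<lambda>\<omega>. gated_product n (\<lambda>i. D i \<omega>) (\<lambda>i. W i \<omega>) j j')"
  proof (rule pushforward[symmetric, OF indep_K nonempty(2) _ K])
    fix \<omega> assume "\<omega> \<in> space M"
    then show "gated_product n (\<lambda>i. D i \<omega>) (\<lambda>i. W i \<omega>) j j' = mask_product n j (\<lambda>c\<in>?K. X c \<omega>) j'"
      unfolding mask_product_def by (intro gated_product_cong weights masks) auto
  qed auto
  finally show ?thesis .
qed

end
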